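(* Let $f\in D_{\mathbb V}(\Delta)$. Then there exist $f_n\in D_{\mathbb V}(\Delta)\cap D_{L^\infty}(\Delta)$ such that $f_n\to f$ in $\mathbb V$ and $\Delta f_n\to\Delta f$ in $\mathbb V$. In particular, for $K\in\mathbb R$, $N\in[1,\infty]$ and $\nu:=1/N$ ($\nu=0$ if $N=\infty$), $\mathsf{BE}(K,N)$ holds if and only if $$\mathbf\Gamma_2(f;\varphi)\ge K\int_X\Gamma(f)\,\varphi\,d\mathfrak m+\nu\int_X(\Delta f)^2\varphi\,d\mathfrak m$$ holds for all $f\in D_{\mathbb V}(\Delta)\cap D_{L^\infty}(\Delta)$ and all nonnegative $\varphi\in D_{L^\infty}(\Delta)$.
   Context: Setting. $(X,\tau)$ is a Polish topological space with a $\sigma$-finite Borel measure $\mathfrak m$ with $\operatorname{supp}(\mathfrak m)=X$. $\mathcal E$ is a symmetric Dirichlet form on $L^2(X,\mathfrak m)$ with dense domain $\mathbb V:=D(\mathcal E)$, strongly local ($\mathcal E(f,g)=0$ whenever $f,g\in\mathbb V$ and $(f+a)g=0$ $\mathfrak m$-a.e. for some $a\in\mathbb R$), admitting a carré du champ, i.e. a symmetric bilinear continuous map $\Gamma:\mathbb V\times\mathbb V\to L^1(X,\mathfrak m)$ with $\int\Gamma(f,f)\varphi\,d\mathfrak m=\mathcal E(f,f\varphi)-\frac12\mathcal E(f^2,\varphi)$ for $f,\varphi\in\mathbb V\cap L^\infty$ and $\mathcal E(f,g)=\int\Gamma(f,g)\,d\mathfrak m$; $\Gamma(f):=\Gamma(f,f)$.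 The associated Markov semigroup is mass-preserving ($\int \mathsf P_tf\,d\mathfrak m=\int f\,d\mathfrak m$ for $f\in L^1\cap L^2$). $\mathbb V$ has the norm $\|f\|_{\mathbb V}^2=\int(f^2+\Gamma(f))\,d\mathfrak m$. For $f\in\mathbb V$, $\Delta f\in\mathbb V'$ is defined by $\langle-\Delta f,g\rangle=\mathcal E(f,g)$; $\Delta f\in L^2$ means $\mathcal E(f,g)=-\int hg\,d\mathfrak m$ for all $g\in\mathbb V$ and some $h\in L^2$, and then $\Delta f:=h$. $D_{L^\infty}(\Delta):=\{f\in\mathbb V\cap L^\infty:\Delta f\in L^2\cap L^\infty\}$; $D_{\mathbb V}(\Delta):=\{f\in\mathbb V:\Delta f\in\mathbb V\}$. For $f\in D_{\mathbb V}(\Delta)$, $\varphi\in D_{L^\infty}(\Delta)$: $\mathbf\Gamma_2(f;\varphi):=\int_X\big(\frac12\Gamma(f)\Delta\varphi-\Gamma(f,\Delta f)\varphi\big)d\mathfrak m$. $\mathsf{BE}(K,N)$ means that the inequality $\mathbf\Gamma_2(f;\varphi)\ge K\int_X\Gamma(f)\varphi\,d\mathfrak m+\nu\int_X(\Delta f)^2\varphi\,d\mathfrak m$ holds for all $(f,\varphi)\in D_{\mathbb V}(\Delta)\times D_{L^\infty}(\Delta)$ with $\varphi\ge0$. *)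

theory Defs
  imports "HOL-Analysis.Analysis"
begin

text \<open>
  Elements of \<open>L\<^sup>p(X, m)\<close> are represented by measurable functions. A subset of \<open>L\<^sup>2\<close> is
  a set of functions saturated under a.e. equality (among measurable functions), and maps between
  such spaces respect a.e. equality.
\<close>

definition msupport :: "'a::topological_space measure \<Rightarrow> 'a set" where
  "msupport M = {x. \<forall>U. open U \<and> x \<in> U \<longrightarrow> emeasure M U > 0}"

definition L2 :: "'a measure \<Rightarrow> ('a \<Rightarrow> real) set" where
  "L2 M = {f \<in> borel_measurable M. integrable M (\<lambda>x. (f x)\<^sup>2)}"

definition L2norm :: "'a measure \<Rightarrow> ('a \<Rightarrow> real) \<Rightarrow> real" where
  "L2norm M f = sqrt (\<integral>x. (f x)\<^sup>2 \<partial>M)"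

definition Linf :: "'a measure \<Rightarrow> ('a \<Rightarrow> real) set" where
  "Linf M = {f \<in> borel_measurable M. \<exists>C. AE x in M. \<bar>f x\<bar> \<le> C}"

text \<open>
  A symmetric Dirichlet form on \<open>L\<^sup>2\<close> with domain \<open>V\<close>: a densely defined, nonnegative, symmetric
  bilinear form that is closed (\<open>V\<close> is complete for \<open>\<parallel>f\<parallel>\<^sup>2 + \<E>(f,f)\<close>) and Markovian
  (the unit contraction operates).  Values of \<open>\<E>\<close> outside \<open>V\<close> are irrelevant.
\<close>

definition dirichlet_form ::
  "'a measure \<Rightarrow> ('a \<Rightarrow> real) set \<Rightarrow> (('a \<Rightarrow> real) \<Rightarrow> ('a \<Rightarrow> real) \<Rightarrow> real) \<Rightarrow> bool" where
  "dirichlet_form M V \<E> \<longleftrightarrow>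
     V \<subseteq> L2 M \<and>
     (\<forall>f\<in>V. \<forall>g\<in>borel_measurable M. (AE x in M. f x = g x) \<longrightarrow> g \<in> V) \<and>
     (\<forall>f\<in>V. \<forall>f'\<in>V. \<forall>g\<in>V. (AE x in M. f x = f' x) \<longrightarrow> \<E> f g = \<E> f' g) \<and>
     (\<lambda>x. 0) \<in> V \<and>
     (\<forall>f\<in>V. \<forall>g\<in>V. (\<lambda>x. f x + g x) \<in> V) \<and>
     (\<forall>f\<in>V. \<forall>c. (\<lambda>x. c * f x) \<in> V) \<and>
     (\<forall>f\<in>V. \<forall>g\<in>V. \<E> f g = \<E> g f) \<and>
     (\<forall>f\<in>V. \<forall>g\<in>V. \<forall>h\<in>V. \<E> (\<lambda>x. f x + g x) h = \<E> f h + \<E> g h) \<and>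
     (\<forall>f\<in>V. \<forall>h\<in>V. \<forall>c. \<E> (\<lambda>x. c * f x) h = c * \<E> f h) \<and>
     (\<forall>f\<in>V. \<E> f f \<ge> 0) \<and>
     (\<forall>f\<in>L2 M. \<forall>e>0. \<exists>g\<in>V. L2norm M (\<lambda>x. f x - g x) < e) \<and>
     (\<forall>u :: nat \<Rightarrow> 'a \<Rightarrow> real.
        (\<forall>n. u n \<in> V) \<and>
        (\<forall>e>0. \<exists>n0. \<forall>m\<ge>n0. \<forall>n\<ge>n0.
           (L2norm M (\<lambda>x. u m x - u n x))\<^sup>2
             + \<E> (\<lambda>x. u m x - u n x) (\<lambda>x. u m x - u n x) < e) \<longrightarrow>
        (\<exists>f\<in>V. (\<lambda>n. (L2norm M (\<lambda>x. u n x - f x))\<^sup>2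
             + \<E> (\<lambda>x. u n x - f x) (\<lambda>x. u n x - f x)) \<longlonglongrightarrow> 0)) \<and>
     (\<forall>f\<in>V. (\<lambda>x. min (max (f x) 0) 1) \<in> V \<and>
        \<E> (\<lambda>x. min (max (f x) 0) 1) (\<lambda>x. min (max (f x) 0) 1) \<le> \<E> f f)"

definition strongly_local ::
  "'a measure \<Rightarrow> ('a \<Rightarrow> real) set \<Rightarrow> (('a \<Rightarrow> real) \<Rightarrow> ('a \<Rightarrow> real) \<Rightarrow> real) \<Rightarrow> bool" where
  "strongly_local M V \<E> \<longleftrightarrow>
     (\<forall>f\<in>V. \<forall>g\<in>V. (\<exists>a. AE x in M. (f x + a) * g x = 0) \<longrightarrow> \<E> f g = 0)"

definition Vnorm ::
  "'a measure \<Rightarrow> (('a \<Rightarrow> real) \<Rightarrow> ('a \<Rightarrow> real) \<Rightarrow> 'a \<Rightarrow> real) \<Rightarrow> ('a \<Rightarrow> real) \<Rightarrow> real" where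
  "Vnorm M \<Gamma> f = sqrt (\<integral>x. (f x)\<^sup>2 + \<Gamma> f f x \<partial>M)"

text \<open>
  Continuity of \<open>\<Gamma>\<close> is stated sequentially.  In the defining identity, \<open>f \<phi>\<close> and \<open>f\<^sup>2\<close> lie in
  \<open>V\<close> because the bounded functions in the domain of a Dirichlet form are an algebra.
\<close>

definition carre_du_champ ::
  "'a measure \<Rightarrow> ('a \<Rightarrow> real) set \<Rightarrow> (('a \<Rightarrow> real) \<Rightarrow> ('a \<Rightarrow> real) \<Rightarrow> real)
     \<Rightarrow> (('a \<Rightarrow> real) \<Rightarrow> ('a \<Rightarrow> real) \<Rightarrow> 'a \<Rightarrow> real) \<Rightarrow> bool" where
  "carre_du_champ M V \<E> \<Gamma> \<longleftrightarrow>
     (\<forall>f\<in>V. \<forall>g\<in>V. integrable M (\<Gamma> f g)) \<and>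
     (\<forall>f\<in>V. \<forall>f'\<in>V. \<forall>g\<in>V. (AE x in M. f x = f' x) \<longrightarrow> (AE x in M. \<Gamma> f g x = \<Gamma> f' g x)) \<and>
     (\<forall>f\<in>V. \<forall>g\<in>V. AE x in M. \<Gamma> f g x = \<Gamma> g f x) \<and>
     (\<forall>f\<in>V. \<forall>g\<in>V. \<forall>h\<in>V. AE x in M. \<Gamma> (\<lambda>y. f y + g y) h x = \<Gamma> f h x + \<Gamma> g h x) \<and>
     (\<forall>f\<in>V. \<forall>h\<in>V. \<forall>c. AE x in M. \<Gamma> (\<lambda>y. c * f y) h x = c * \<Gamma> f h x) \<and>
     (\<forall>(u :: nat \<Rightarrow> 'a \<Rightarrow> real) v. \<forall>f\<in>V. \<forall>g\<in>V.
        (\<forall>n. u n \<in> V) \<and> (\<forall>n. v n \<in> V) \<and>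
        (\<lambda>n. Vnorm M \<Gamma> (\<lambda>x. u n x - f x)) \<longlonglongrightarrow> 0 \<and>
        (\<lambda>n. Vnorm M \<Gamma> (\<lambda>x. v n x - g x)) \<longlonglongrightarrow> 0 \<longrightarrow>
        (\<lambda>n. \<integral>x. \<bar>\<Gamma> (u n) (v n) x - \<Gamma> f g x\<bar> \<partial>M) \<longlonglongrightarrow> 0) \<and>
     (\<forall>f\<in>V \<inter> Linf M. \<forall>\<phi>\<in>V \<inter> Linf M.
        (\<integral>x. \<Gamma> f f x * \<phi> x \<partial>M) = \<E> f (\<lambda>x. f x * \<phi> x) - 1/2 * \<E> (\<lambda>x. (f x)\<^sup>2) \<phi>) \<and>
     (\<forall>f\<in>V. \<forall>g\<in>V. \<E> f g = (\<integral>x. \<Gamma> f g x \<partial>M))"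

definition has_laplacian ::
  "'a measure \<Rightarrow> ('a \<Rightarrow> real) set \<Rightarrow> (('a \<Rightarrow> real) \<Rightarrow> ('a \<Rightarrow> real) \<Rightarrow> real)
     \<Rightarrow> ('a \<Rightarrow> real) \<Rightarrow> ('a \<Rightarrow> real) \<Rightarrow> bool" where
  "has_laplacian M V \<E> f h \<longleftrightarrow>
     f \<in> V \<and> h \<in> L2 M \<and> (\<forall>g\<in>V. \<E> f g = - (\<integral>x. h x * g x \<partial>M))"

text \<open>
  By density of \<open>V\<close> in \<open>L\<^sup>2\<close> the function \<open>h\<close> above is unique up to a.e. equality;
  \<open>laplacian\<close> picks a representative.
\<close>

definition laplacian ::
  "'a measure \<Rightarrow> ('a \<Rightarrow> real) set \<Rightarrow> (('a \<Rightarrow> real) \<Rightarrow> ('a \<Rightarrow> real) \<Rightarrow> real)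
     \<Rightarrow> ('a \<Rightarrow> real) \<Rightarrow> 'a \<Rightarrow> real" where
  "laplacian M V \<E> f = (SOME h. has_laplacian M V \<E> f h)"

definition DLap ::
  "'a measure \<Rightarrow> ('a \<Rightarrow> real) set \<Rightarrow> (('a \<Rightarrow> real) \<Rightarrow> ('a \<Rightarrow> real) \<Rightarrow> real)
     \<Rightarrow> ('a \<Rightarrow> real) set" where
  "DLap M V \<E> = {f \<in> V. \<exists>h. has_laplacian M V \<E> f h}"

definition DLap_V ::
  "'a measure \<Rightarrow> ('a \<Rightarrow> real) set \<Rightarrow> (('a \<Rightarrow> real) \<Rightarrow> ('a \<Rightarrow> real) \<Rightarrow> real)
     \<Rightarrow> ('a \<Rightarrow> real) set" where
  "DLap_V M V \<E> = {f \<in> DLap M V \<E>. laplacian M V \<E> f \<in> V}"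

definition DLap_Linf ::
  "'a measure \<Rightarrow> ('a \<Rightarrow> real) set \<Rightarrow> (('a \<Rightarrow> real) \<Rightarrow> ('a \<Rightarrow> real) \<Rightarrow> real)
     \<Rightarrow> ('a \<Rightarrow> real) set" where
  "DLap_Linf M V \<E> = {f \<in> DLap M V \<E> \<inter> Linf M. laplacian M V \<E> f \<in> Linf M}"

text \<open>
  The Markov semigroup associated with \<open>\<E>\<close>: the strongly continuous semigroup of linear Markov
  contractions of \<open>L\<^sup>2\<close> whose infinitesimal generator is the Laplacian of \<open>\<E>\<close>, domain included.
  It is determined by \<open>\<E>\<close> up to a.e. equality.
\<close>

definition markov_semigroup ::
  "'a measure \<Rightarrow> ('a \<Rightarrow> real) set \<Rightarrow> (('a \<Rightarrow> real) \<Rightarrow> ('a \<Rightarrow> real) \<Rightarrow> real)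
     \<Rightarrow> (real \<Rightarrow> ('a \<Rightarrow> real) \<Rightarrow> 'a \<Rightarrow> real) \<Rightarrow> bool" where
  "markov_semigroup M V \<E> P \<longleftrightarrow>
     (\<forall>t\<ge>0. \<forall>f\<in>L2 M. P t f \<in> L2 M \<and> L2norm M (P t f) \<le> L2norm M f) \<and>
     (\<forall>t\<ge>0. \<forall>f\<in>L2 M. \<forall>g\<in>L2 M. AE x in M. P t (\<lambda>y. f y + g y) x = P t f x + P t g x) \<and>
     (\<forall>t\<ge>0. \<forall>f\<in>L2 M. \<forall>c. AE x in M. P t (\<lambda>y. c * f y) x = c * P t f x) \<and>
     (\<forall>t\<ge>0. \<forall>f\<in>L2 M. (AE x in M. 0 \<le> f x \<and> f x \<le> 1) \<longrightarrow>
        (AE x in M. 0 \<le> P t f x \<and> P t f x \<le> 1)) \<and>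
     (\<forall>f\<in>L2 M. AE x in M. P 0 f x = f x) \<and>
     (\<forall>s\<ge>0. \<forall>t\<ge>0. \<forall>f\<in>L2 M. AE x in M. P (s + t) f x = P s (P t f) x) \<and>
     (\<forall>f\<in>L2 M. ((\<lambda>t. L2norm M (\<lambda>x. P t f x - f x)) \<longlongrightarrow> 0) (at_right 0)) \<and>
     (\<forall>f\<in>L2 M. \<forall>h\<in>L2 M.
        ((\<lambda>t. L2norm M (\<lambda>x. (P t f x - f x) / t - h x)) \<longlongrightarrow> 0) (at_right 0) \<longleftrightarrow>
        has_laplacian M V \<E> f h)"

definition mass_preserving ::
  "'a measure \<Rightarrow> (real \<Rightarrow> ('a \<Rightarrow> real) \<Rightarrow> 'a \<Rightarrow> real) \<Rightarrow> bool" where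
  "mass_preserving M P \<longleftrightarrow>
     (\<forall>t\<ge>0. \<forall>f\<in>L2 M. integrable M f \<longrightarrow>
        integrable M (P t f) \<and> (\<integral>x. P t f x \<partial>M) = (\<integral>x. f x \<partial>M))"

definition Gamma2 ::
  "'a measure \<Rightarrow> ('a \<Rightarrow> real) set \<Rightarrow> (('a \<Rightarrow> real) \<Rightarrow> ('a \<Rightarrow> real) \<Rightarrow> real)
     \<Rightarrow> (('a \<Rightarrow> real) \<Rightarrow> ('a \<Rightarrow> real) \<Rightarrow> 'a \<Rightarrow> real)
     \<Rightarrow> ('a \<Rightarrow> real) \<Rightarrow> ('a \<Rightarrow> real) \<Rightarrow> real" where
  "Gamma2 M V \<E> \<Gamma> f \<phi> =
     (\<integral>x. 1/2 * \<Gamma> f f x * laplacian M V \<E> \<phi> x - \<Gamma> f (laplacian M V \<E> f) x * \<phi> x \<partial>M)"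

definition inv_dim :: "ereal \<Rightarrow> real" where
  "inv_dim N = (if N = \<infinity> then 0 else 1 / real_of_ereal N)"

definition BE ::
  "'a measure \<Rightarrow> ('a \<Rightarrow> real) set \<Rightarrow> (('a \<Rightarrow> real) \<Rightarrow> ('a \<Rightarrow> real) \<Rightarrow> real)
     \<Rightarrow> (('a \<Rightarrow> real) \<Rightarrow> ('a \<Rightarrow> real) \<Rightarrow> 'a \<Rightarrow> real) \<Rightarrow> real \<Rightarrow> ereal \<Rightarrow> bool" where
  "BE M V \<E> \<Gamma> K N \<longleftrightarrow>
     (\<forall>f\<in>DLap_V M V \<E>. \<forall>\<phi>\<in>DLap_Linf M V \<E>. (AE x in M. 0 \<le> \<phi> x) \<longrightarrow>
        Gamma2 M V \<E> \<Gamma> f \<phi> \<ge>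
          K * (\<integral>x. \<Gamma> f f x * \<phi> x \<partial>M)
          + inv_dim N * (\<integral>x. (laplacian M V \<E> f x)\<^sup>2 * \<phi> x \<partial>M))"

end

theory Submission
  imports Defs
begin

text \<open>
  Let \<open>f\<close> have a Laplacian in \<open>V\<close>. Then \<open>h = f - \<Delta> f\<close> lies in \<open>V\<close> and \<open>f\<close> is the resolvent
  \<open>(I - \<Delta>)\<inverse> h\<close>. The approximations are \<open>F\<^sub>n = (I - \<Delta>)\<inverse> h\<^sub>n\<close>, where \<open>h\<^sub>n\<close> is \<open>h\<close> truncated to
  \<open>[-(n+1), n+1]\<close>. Three facts make them work.

  The resolvent exists on all of \<open>L\<^sup>2\<close>, by Riesz representation in the Hilbert space \<open>V\<close> with inner
  product \<open>E1 f g = \<integral> f g + \<E> f g\<close> (\<open>Riesz_representation\<close>, \<open>resolvent_exists\<close>), and it is a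
  contraction from \<open>L\<^sup>2\<close> to \<open>V\<close> (\<open>resolvent_energy_le\<close>).

  The resolvent preserves the bound \<open>\<bar>g\<bar> \<le> c\<close> (\<open>resolvent_bounded\<close>). Hence \<open>F\<^sub>n\<close> is bounded, and so
  is \<open>\<Delta> F\<^sub>n = F\<^sub>n - h\<^sub>n\<close>, which moreover lies in \<open>V\<close>.

  Truncations converge in \<open>V\<close> (\<open>truncate_tendsto\<close>). Strong locality makes the slices of a function
  between successive truncation levels \<open>\<E>\<close>-orthogonal, so the energies of the truncations increase;
  being bounded they converge, and the truncations are Cauchy in \<open>V\<close>.

  Consequently \<open>F\<^sub>n - f = (I - \<Delta>)\<inverse> (h\<^sub>n - h)\<close> and \<open>\<Delta> F\<^sub>n - \<Delta> f = (F\<^sub>n - f) - (h\<^sub>n - h)\<close> both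
  tend to \<open>0\<close> in \<open>V\<close>. The equivalence for the curvature-dimension inequality follows because,
  for \<open>\<phi>\<close> and \<open>\<Delta> \<phi>\<close> bounded, each of its terms is continuous along this convergence: \<open>\<Gamma>\<close> is
  continuous into \<open>L\<^sup>1\<close> and squaring is continuous from \<open>L\<^sup>2\<close> to \<open>L\<^sup>1\<close> (\<open>BE_terms_tendsto\<close>).
\<close>

section \<open>Semi-inner products on spaces of functions\<close>

text \<open>
  A quadratic polynomial without negative values has nonpositive discriminant. Allowing \<open>c = 0\<close>
  makes the bound applicable to vectors of zero length.
\<close>

lemma discriminant_nonpos:
  fixes a b c :: real
  assumes "\<And>t. 0 \<le> a + 2 * t * b + t\<^sup>2 * c"
  shows "b\<^sup>2 \<le> a * c"
proof (cases "c > 0")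
  case True
  have "0 \<le> (a + 2 * (- b / c) * b + (- b / c)\<^sup>2 * c) * c"
    using assms[of "- b / c"] True by simp
  also have "\<dots> = a * c - b\<^sup>2"
    using True by (simp add: field_simps power2_eq_square)
  finally show ?thesis by simp
next
  case False
  have "b = 0"
  proof (rule ccontr)
    assume b: "b \<noteq> 0"
    (* here the linear part a + 2 t b equals -1 *)
    define t where "t = - (a + 1) / (2 * b)"
    have "2 * t * b = - (a + 1)"
      using b by (simp add: t_def)
    moreover have "t\<^sup>2 * c \<le> 0"
      using False by (simp add: mult_nonneg_nonpos)
    ultimately show False
      using assms[of t] by linarith
  qed
  moreover have "a * c \<ge> 0"
  proof (cases "c = 0")
    case False
    have a: "0 \<le> a" using assms[of 0] by simp
    (* again a value of -1, now for c < 0 *)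
    define t where "t = sqrt ((a + 1) / (- c))"
    have "t\<^sup>2 = (a + 1) / (- c)"
      unfolding t_def using a False \<open>\<not> c > 0\<close> by (intro real_sqrt_pow2) (auto simp: field_simps)
    then have "t\<^sup>2 * c = - (a + 1)"
      using False by (simp add: field_simps)
    then show ?thesis
      using assms[of t] \<open>b = 0\<close> by simp
  qed simp
  ultimately show ?thesis by simp
qed

text \<open>
  The forms at hand are only semidefinite, functions being identified almost everywhere and
  \<open>\<E>\<close> being possibly degenerate. The locale serves three times: for \<open>\<E>\<close>, for the \<open>L\<^sup>2\<close> product,
  and for their sum.
\<close>

locale function_form =
  fixes V :: "('a \<Rightarrow> real) set" and B :: "('a \<Rightarrow> real) \<Rightarrow> ('a \<Rightarrow> real) \<Rightarrow> real"
  assumes zero_mem: "(\<lambda>x. 0) \<in> V"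
    and add_mem: "\<lbrakk>f \<in> V; g \<in> V\<rbrakk> \<Longrightarrow> (\<lambda>x. f x + g x) \<in> V"
    and scale_mem: "f \<in> V \<Longrightarrow> (\<lambda>x. c * f x) \<in> V"
    and sym: "\<lbrakk>f \<in> V; g \<in> V\<rbrakk> \<Longrightarrow> B f g = B g f"
    and add_left: "\<lbrakk>f \<in> V; g \<in> V; h \<in> V\<rbrakk> \<Longrightarrow> B (\<lambda>x. f x + g x) h = B f h + B g h"
    and scale_left: "\<lbrakk>f \<in> V; h \<in> V\<rbrakk> \<Longrightarrow> B (\<lambda>x. c * f x) h = c * B f h"
    and nonneg: "f \<in> V \<Longrightarrow> 0 \<le> B f f"
begin

lemma add_right: "\<lbrakk>f \<in> V; g \<in> V; h \<in> V\<rbrakk> \<Longrightarrow> B h (\<lambda>x. f x + g x) = B h f + B h g"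
  using add_left[of f g h] sym[of h] by (simp add: add_mem)

lemma scale_right: "\<lbrakk>f \<in> V; h \<in> V\<rbrakk> \<Longrightarrow> B h (\<lambda>x. c * f x) = c * B h f"
  using scale_left[of f h c] sym[of h] by (simp add: scale_mem)

lemma uminus_mem: "f \<in> V \<Longrightarrow> (\<lambda>x. - f x) \<in> V"
  using scale_mem[of f "-1"] by simp

lemma diff_mem: "\<lbrakk>f \<in> V; g \<in> V\<rbrakk> \<Longrightarrow> (\<lambda>x. f x - g x) \<in> V"
  using add_mem[OF _ uminus_mem, of f g] by simp

lemma diff_left: "\<lbrakk>f \<in> V; g \<in> V; h \<in> V\<rbrakk> \<Longrightarrow> B (\<lambda>x. f x - g x) h = B f h - B g h"
  using add_left[of f "\<lambda>x. -1 * g x" h] scale_left[of g h "-1"] scale_mem[of g "-1"] by simp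

lemma diff_right: "\<lbrakk>f \<in> V; g \<in> V; h \<in> V\<rbrakk> \<Longrightarrow> B h (\<lambda>x. f x - g x) = B h f - B h g"
  using diff_left[of f g h] sym[of h] by (simp add: diff_mem)

lemma diff_square:
  "\<lbrakk>f \<in> V; g \<in> V\<rbrakk> \<Longrightarrow> B (\<lambda>x. f x - g x) (\<lambda>x. f x - g x) = B f f - 2 * B f g + B g g"
  using sym[of f g] by (simp add: diff_left diff_right diff_mem)

lemma add_square:
  "\<lbrakk>f \<in> V; g \<in> V\<rbrakk> \<Longrightarrow> B (\<lambda>x. f x + g x) (\<lambda>x. f x + g x) = B f f + 2 * B f g + B g g"
  using sym[of f g] by (simp add: add_left add_right add_mem)

lemma diff_square_le:
  assumes "f \<in> V" "g \<in> V"
  shows "B (\<lambda>x. f x - g x) (\<lambda>x. f x - g x) \<le> 2 * B f f + 2 * B g g"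
  using nonneg[OF add_mem[OF assms]] diff_square[OF assms] add_square[OF assms] by linarith

lemma Cauchy_Schwarz:
  assumes "f \<in> V" "g \<in> V"
  shows "(B f g)\<^sup>2 \<le> B f f * B g g"
proof (rule discriminant_nonpos)
  fix t :: real
  have "0 \<le> B (\<lambda>x. f x + t * g x) (\<lambda>x. f x + t * g x)"
    using assms by (intro nonneg add_mem scale_mem)
  also have "\<dots> = B f f + 2 * t * B f g + t\<^sup>2 * B g g"
    using assms by (simp add: add_square scale_mem scale_left scale_right power2_eq_square)
  finally show "0 \<le> B f f + 2 * t * B f g + t\<^sup>2 * B g g" .
qed

lemma tendsto_left:
  assumes u: "\<And>n. u n \<in> V" and f: "f \<in> V" and g: "g \<in> V"
    and lim: "(\<lambda>n. B (\<lambda>x. u n x - f x) (\<lambda>x. u n x - f x)) \<longlonglongrightarrow> 0"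
  shows "(\<lambda>n. B (u n) g) \<longlonglongrightarrow> B f g"
proof -
  have "(\<lambda>n. (B (u n) g - B f g)\<^sup>2) \<longlonglongrightarrow> 0"
  proof (rule tendsto_sandwich[OF _ _ tendsto_const])
    show "(\<lambda>n. B (\<lambda>x. u n x - f x) (\<lambda>x. u n x - f x) * B g g) \<longlonglongrightarrow> 0"
      using tendsto_mult_left_zero[OF lim] .
    show "\<forall>\<^sub>F n in sequentially. (B (u n) g - B f g)\<^sup>2
        \<le> B (\<lambda>x. u n x - f x) (\<lambda>x. u n x - f x) * B g g"
      using Cauchy_Schwarz[OF diff_mem[OF u f] g] by (auto simp: diff_left u f g)
  qed auto
  then have "(\<lambda>n. sqrt ((B (u n) g - B f g)\<^sup>2)) \<longlonglongrightarrow> sqrt 0"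
    by (rule tendsto_real_sqrt)
  then show ?thesis
    by (simp add: tendsto_rabs_zero_iff LIM_zero_iff)
qed

definition form_Cauchy :: "(nat \<Rightarrow> 'a \<Rightarrow> real) \<Rightarrow> bool" where
  "form_Cauchy u \<longleftrightarrow> (\<forall>e>0. \<exists>n0. \<forall>m\<ge>n0. \<forall>n\<ge>n0.
      B (\<lambda>x. u m x - u n x) (\<lambda>x. u m x - u n x) < e)"

text \<open>
  Orthogonality of the increments makes \<open>B (u n) (u n)\<close> increasing, with
  \<open>B (u m - u n) (u m - u n) = B (u m) (u m) - B (u n) (u n)\<close>; a bounded increasing real sequence
  is Cauchy.
\<close>

lemma Cauchy_of_orthogonal_increments:
  assumes u: "\<And>n. u n \<in> V"
    and orth: "\<And>n m. n \<le> m \<Longrightarrow> B (u n) (\<lambda>x. u m x - u n x) = 0"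
    and bdd: "\<And>n. B (u n) (u n) \<le> C"
  shows "form_Cauchy u"
proof -
  let ?b = "\<lambda>n. B (u n) (u n)"
  have inc: "B (\<lambda>x. u m x - u n x) (\<lambda>x. u m x - u n x) = ?b m - ?b n" if "n \<le> m" for n m
    using orth[OF that] sym[OF u u, of m n] by (simp add: diff_square diff_right u)
  have sq_sym: "B (\<lambda>x. u m x - u n x) (\<lambda>x. u m x - u n x)
      = B (\<lambda>x. u n x - u m x) (\<lambda>x. u n x - u m x)" for m n
    using sym[OF u u, of m n] by (simp add: diff_square u)
  have "incseq ?b"
  proof (rule monoI)
    show "?b n \<le> ?b m" if "n \<le> m" for n m
      using inc[OF that] nonneg[OF diff_mem[OF u u], of m n] by simp
  qed
  then obtain L where "?b \<longlonglongrightarrow> L"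
    using incseq_convergent[of ?b C] bdd by metis
  then have "Cauchy ?b"
    by (rule LIMSEQ_imp_Cauchy)
  show ?thesis
    unfolding form_Cauchy_def
  proof (intro allI impI)
    fix e :: real assume "e > 0"
    with \<open>Cauchy ?b\<close> obtain n0 where n0: "\<And>m n. m \<ge> n0 \<Longrightarrow> n \<ge> n0 \<Longrightarrow> \<bar>?b m - ?b n\<bar> < e"
      unfolding Cauchy_def dist_real_def by meson
    have "B (\<lambda>x. u m x - u n x) (\<lambda>x. u m x - u n x) < e" if "m \<ge> n0" "n \<ge> n0" for m n
      using n0[OF that] n0[OF that(2,1)] inc[of n m] inc[of m n] sq_sym[of m n]
      by (cases "n \<le> m") auto
    then show "\<exists>n0. \<forall>m\<ge>n0. \<forall>n\<ge>n0. B (\<lambda>x. u m x - u n x) (\<lambda>x. u m x - u n x) < e"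
      by blast
  qed
qed

text \<open>
  Riesz representation. The representing vector is the limit of a minimising sequence of
  \<open>J u = B u u - 2 * L u\<close>: the parallelogram identity makes the sequence Cauchy, and comparing
  \<open>J (u n)\<close> with \<open>J (u n + t v)\<close> for all \<open>t\<close> shows that \<open>B (u n) v - L v\<close> tends to zero, so that
  the minimality of the limit itself never has to be discussed.
\<close>

lemma Riesz_representation:
  assumes complete: "\<And>u. \<lbrakk>\<And>n. u n \<in> V; form_Cauchy u\<rbrakk>
      \<Longrightarrow> \<exists>f\<in>V. (\<lambda>n. B (\<lambda>x. u n x - f x) (\<lambda>x. u n x - f x)) \<longlonglongrightarrow> 0"
    and L_add: "\<And>f g. \<lbrakk>f \<in> V; g \<in> V\<rbrakk> \<Longrightarrow> L (\<lambda>x. f x + g x) = L f + L g"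
    and L_scale: "\<And>f c. f \<in> V \<Longrightarrow> L (\<lambda>x. c * f x) = c * L f"
    and L_bdd: "\<And>f. f \<in> V \<Longrightarrow> (L f)\<^sup>2 \<le> C * B f f"
  shows "\<exists>u\<in>V. \<forall>v\<in>V. B u v = L v"
proof -
  define J where "J = (\<lambda>u. B u u - 2 * L u)"
  define d where "d = Inf (J ` V)"
  have J_ge: "- \<bar>C\<bar> \<le> J f" if f: "f \<in> V" for f
  proof -
    have "(L f)\<^sup>2 \<le> \<bar>C\<bar> * B f f"
      using L_bdd[OF f] nonneg[OF f] by (meson abs_ge_self mult_right_mono order_trans)
    also have "\<bar>C\<bar> * B f f \<le> ((\<bar>C\<bar> + B f f) / 2)\<^sup>2"
    proof -
      have "((a + b) / 2)\<^sup>2 - a * b = ((a - b) / 2)\<^sup>2" for a b :: real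
        by (simp add: power2_eq_square field_simps)
      from this[of "\<bar>C\<bar>" "B f f"] show ?thesis
        by (metis diff_ge_0_iff_ge zero_le_power2)
    qed
    finally have "L f \<le> (\<bar>C\<bar> + B f f) / 2"
      by (rule power2_le_imp_le) (use nonneg[OF f] in auto)
    then show ?thesis by (simp add: J_def)
  qed
  then have bdd: "bdd_below (J ` V)"
    by (rule bdd_belowI2)
  have d_le: "d \<le> J f" if "f \<in> V" for f
    unfolding d_def using bdd that by (rule cINF_lower)
  have "\<exists>f\<in>V. J f < d + 1 / real (Suc n)" for n
  proof -
    have "Inf (J ` V) < d + 1 / real (Suc n)"
      by (simp add: d_def)
    then show ?thesis
      using cInf_lessD[of "J ` V"] zero_mem by blast
  qed
  then obtain u where u: "\<And>n. u n \<in> V" and J_u: "\<And>n. J (u n) < d + 1 / real (Suc n)"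
    by metis
  have parallelogram: "B (\<lambda>x. f x - g x) (\<lambda>x. f x - g x)
      = 2 * J f + 2 * J g - 4 * J (\<lambda>x. 1/2 * (f x + g x))" if "f \<in> V" "g \<in> V" for f g
    using that unfolding J_def
    by (simp only: diff_square add_square add_mem scale_mem scale_left scale_right L_add L_scale)
       (simp add: algebra_simps)
  have "form_Cauchy u"
    unfolding form_Cauchy_def
  proof (intro allI impI)
    fix e :: real assume "e > 0"
    then obtain n0 where n0: "1 / real (Suc n0) < e / 4"
      using nat_approx_posE[of "e / 4"] by auto
    have "B (\<lambda>x. u m x - u n x) (\<lambda>x. u m x - u n x) < e" if "m \<ge> n0" "n \<ge> n0" for m n
    proof -
      have "1 / real (Suc m) \<le> 1 / real (Suc n0)" "1 / real (Suc n) \<le> 1 / real (Suc n0)"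
        using that by (auto simp: field_simps)
      then show ?thesis
        using parallelogram[OF u u, of m n] J_u[of m] J_u[of n] n0
          d_le[OF scale_mem[OF add_mem[OF u u]], of "1/2" m n] by linarith
    qed
    then show "\<exists>n0. \<forall>m\<ge>n0. \<forall>n\<ge>n0. B (\<lambda>x. u m x - u n x) (\<lambda>x. u m x - u n x) < e"
      by blast
  qed
  from complete[OF u this] obtain f where f: "f \<in> V"
    and lim: "(\<lambda>n. B (\<lambda>x. u n x - f x) (\<lambda>x. u n x - f x)) \<longlonglongrightarrow> 0"
    by (elim bexE)
  have "B f v = L v" if v: "v \<in> V" for v
  proof -
    have le: "(B (u n) v - L v)\<^sup>2 \<le> 1 / real (Suc n) * B v v" for n
    proof (rule discriminant_nonpos)
      fix t :: real
      have "d \<le> J (\<lambda>x. u n x + t * v x)"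
        using u v by (intro d_le add_mem scale_mem)
      also have "\<dots> = J (u n) + 2 * t * (B (u n) v - L v) + t\<^sup>2 * B v v"
        using u v unfolding J_def
        by (simp add: add_square scale_mem scale_left scale_right L_add L_scale)
           (simp add: algebra_simps power2_eq_square)
      finally show "0 \<le> 1 / real (Suc n) + 2 * t * (B (u n) v - L v) + t\<^sup>2 * B v v"
        using J_u[of n] by linarith
    qed
    have "(\<lambda>n. 1 / real (Suc n) * B v v) \<longlonglongrightarrow> 0"
      using LIMSEQ_Suc[OF lim_1_over_n] by (intro tendsto_mult_left_zero)
    then have "(\<lambda>n. (B (u n) v - L v)\<^sup>2) \<longlonglongrightarrow> 0"
      by (rule tendsto_sandwich[OF _ _ tendsto_const, rotated 2]) (use le in auto)
    moreover have "(\<lambda>n. (B (u n) v - L v)\<^sup>2) \<longlonglongrightarrow> (B f v - L v)\<^sup>2"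
      by (intro tendsto_intros tendsto_left u f v lim)
    ultimately have "(B f v - L v)\<^sup>2 = 0"
      using LIMSEQ_unique by blast
    then show ?thesis by simp
  qed
  with f show ?thesis by blast
qed

end

section \<open>Square-integrable functions and bounded weights\<close>

lemma L2_mult_integrable:
  assumes "f \<in> L2 M" "g \<in> L2 M"
  shows "integrable M (\<lambda>x. f x * g x)"
proof (rule Bochner_Integration.integrable_bound)
  show "integrable M (\<lambda>x. (f x)\<^sup>2 + (g x)\<^sup>2)"
    using assms by (auto simp: L2_def)
  show "(\<lambda>x. f x * g x) \<in> borel_measurable M"
    using assms by (auto simp: L2_def)
  have "\<bar>a * b\<bar> \<le> a\<^sup>2 + b\<^sup>2" for a b :: real
    using sum_squares_bound[of "\<bar>a\<bar>" "\<bar>b\<bar>"] mult_nonneg_nonneg[of "\<bar>a\<bar>" "\<bar>b\<bar>"]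
    by (simp add: abs_mult del: mult_nonneg_nonneg)
  then show "AE x in M. norm (f x * g x) \<le> norm ((f x)\<^sup>2 + (g x)\<^sup>2)"
    by simp
qed

lemma L2_add:
  assumes "f \<in> L2 M" "g \<in> L2 M"
  shows "(\<lambda>x. f x + g x) \<in> L2 M"
proof -
  have "integrable M (\<lambda>x. (f x)\<^sup>2 + (g x)\<^sup>2 + 2 * (f x * g x))"
    using assms L2_mult_integrable[OF assms] by (auto simp: L2_def)
  then show ?thesis
    using assms by (auto simp: L2_def power2_sum mult.assoc)
qed

lemma L2_inner_form: "function_form (L2 (M :: 'a measure)) (\<lambda>f g. \<integral>x. f x * g x \<partial>M)"
proof
  show "(\<lambda>x. 0) \<in> L2 M"
    by (simp add: L2_def)
  show "(\<lambda>x. c * f x) \<in> L2 M" if "f \<in> L2 M" for f c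
    using that by (auto simp: L2_def power_mult_distrib)
  show "(\<integral>x. (f x + g x) * h x \<partial>M) = (\<integral>x. f x * h x \<partial>M) + (\<integral>x. g x * h x \<partial>M)"
    if "f \<in> L2 M" "g \<in> L2 M" "h \<in> L2 M" for f g h
    using that by (simp add: distrib_right L2_mult_integrable)
  show "(\<integral>x. c * f x * h x \<partial>M) = c * (\<integral>x. f x * h x \<partial>M)" for f h :: "'a \<Rightarrow> real" and c
    by (simp add: mult.assoc)
  show "(\<integral>x. f x * g x \<partial>M) = (\<integral>x. g x * f x \<partial>M)" for f g :: "'a \<Rightarrow> real"
    by (simp add: mult.commute)
qed (simp_all add: L2_add)

lemma L2norm_squared: "(L2norm M f)\<^sup>2 = (\<integral>x. f x * f x \<partial>M)"
  by (simp add: L2norm_def) (simp add: power2_eq_square)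

lemma L2_eq_AE_of_zero_norm:
  assumes f: "f \<in> L2 M" and zero: "(\<integral>x. f x * f x \<partial>M) = 0"
  shows "AE x in M. f x = 0"
proof -
  have "AE x in M. f x * f x = 0"
    using integral_nonneg_eq_0_iff_AE[OF L2_mult_integrable[OF f f]] zero by simp
  then show ?thesis by simp
qed

lemma bounded_mult_integrable:
  fixes f \<phi> :: "'a \<Rightarrow> real"
  assumes "integrable M f" "\<phi> \<in> Linf M"
  shows "integrable M (\<lambda>x. f x * \<phi> x)"
proof -
  obtain C where C: "AE x in M. \<bar>\<phi> x\<bar> \<le> C"
    using assms by (auto simp: Linf_def)
  show ?thesis
  proof (rule Bochner_Integration.integrable_bound)
    show "integrable M (\<lambda>x. C * f x)"
      using assms by simp
    show "(\<lambda>x. f x * \<phi> x) \<in> borel_measurable M"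
      using assms by (auto simp: Linf_def)
    show "AE x in M. norm (f x * \<phi> x) \<le> norm (C * f x)"
      using C by eventually_elim (auto simp: abs_mult mult.commute intro!: mult_mono)
  qed
qed

lemma L1_tendsto_integral_mult_bounded:
  fixes f :: "'a \<Rightarrow> real"
  assumes u: "\<And>n. integrable M (u n)" and f: "integrable M f" and \<phi>: "\<phi> \<in> Linf M"
    and lim: "(\<lambda>n. \<integral>x. \<bar>u n x - f x\<bar> \<partial>M) \<longlonglongrightarrow> 0"
  shows "(\<lambda>n. \<integral>x. u n x * \<phi> x \<partial>M) \<longlonglongrightarrow> (\<integral>x. f x * \<phi> x \<partial>M)"
proof -
  obtain C where C: "AE x in M. \<bar>\<phi> x\<bar> \<le> C"
    using \<phi> by (auto simp: Linf_def)
  have le: "\<bar>(\<integral>x. u n x * \<phi> x \<partial>M) - (\<integral>x. f x * \<phi> x \<partial>M)\<bar> \<le> (\<integral>x. \<bar>u n x - f x\<bar> \<partial>M) * C" for n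
  proof -
    have int: "integrable M (\<lambda>x. (u n x - f x) * \<phi> x)"
      using u f \<phi> by (intro bounded_mult_integrable) auto
    have "(\<integral>x. u n x * \<phi> x \<partial>M) - (\<integral>x. f x * \<phi> x \<partial>M) = (\<integral>x. (u n x - f x) * \<phi> x \<partial>M)"
      using u f \<phi> by (simp add: left_diff_distrib bounded_mult_integrable)
    also have "\<bar>\<dots>\<bar> \<le> (\<integral>x. \<bar>(u n x - f x) * \<phi> x\<bar> \<partial>M)"
      by (rule integral_abs_bound)
    also have "\<dots> \<le> (\<integral>x. \<bar>u n x - f x\<bar> * C \<partial>M)"
    proof (rule integral_mono_AE)
      show "AE x in M. \<bar>(u n x - f x) * \<phi> x\<bar> \<le> \<bar>u n x - f x\<bar> * C"
        using C by eventually_elim (auto simp: abs_mult intro!: mult_left_mono)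
    qed (use int u f in auto)
    finally show ?thesis by simp
  qed
  show ?thesis
  proof (rule LIM_zero_cancel, rule Lim_null_comparison)
    show "\<forall>\<^sub>F n in sequentially. norm ((\<integral>x. u n x * \<phi> x \<partial>M) - (\<integral>x. f x * \<phi> x \<partial>M))
        \<le> (\<integral>x. \<bar>u n x - f x\<bar> \<partial>M) * C"
      using le by simp
    show "(\<lambda>n. (\<integral>x. \<bar>u n x - f x\<bar> \<partial>M) * C) \<longlonglongrightarrow> 0"
      using lim by (rule tendsto_mult_left_zero)
  qed
qed

text \<open>
  With \<open>a = \<bar>u - f\<bar>\<close> one has \<open>\<bar>u\<^sup>2 - f\<^sup>2\<bar> \<le> a\<^sup>2 + 2 a \<bar>f\<bar>\<close>, and the cross term tends to zero since
  \<open>a\<close> does so in \<open>L\<^sup>2\<close>.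
\<close>

lemma L2_tendsto_imp_squares_L1_tendsto:
  assumes u: "\<And>n. u n \<in> L2 M" and f: "f \<in> L2 M"
    and lim: "(\<lambda>n. \<integral>x. (u n x - f x) * (u n x - f x) \<partial>M) \<longlonglongrightarrow> 0"
  shows "(\<lambda>n. \<integral>x. \<bar>(u n x)\<^sup>2 - (f x)\<^sup>2\<bar> \<partial>M) \<longlonglongrightarrow> 0"
proof -
  interpret L: function_form "L2 M" "\<lambda>f g. \<integral>x. f x * g x \<partial>M"
    by (rule L2_inner_form)
  define a where "a = (\<lambda>n x. \<bar>u n x - f x\<bar>)"
  have d: "(\<lambda>x. u n x - f x) \<in> L2 M" for n
    using u f by (rule L.diff_mem)
  have aL: "a n \<in> L2 M" for n
    using d[of n] by (auto simp: L2_def a_def)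
  have fL: "(\<lambda>x. \<bar>f x\<bar>) \<in> L2 M"
    using f by (auto simp: L2_def)
  have lim': "(\<lambda>n. \<integral>x. a n x * a n x \<partial>M) \<longlonglongrightarrow> 0"
    using lim by (simp add: a_def)
  have cross: "(\<lambda>n. \<integral>x. a n x * \<bar>f x\<bar> \<partial>M) \<longlonglongrightarrow> 0"
    using L.tendsto_left[of a "\<lambda>x. 0" "\<lambda>x. \<bar>f x\<bar>"] aL fL L.zero_mem lim' by simp
  have bound: "(\<integral>x. \<bar>(u n x)\<^sup>2 - (f x)\<^sup>2\<bar> \<partial>M)
      \<le> (\<integral>x. a n x * a n x \<partial>M) + 2 * (\<integral>x. a n x * \<bar>f x\<bar> \<partial>M)" for n
  proof -
    have "(\<integral>x. \<bar>(u n x)\<^sup>2 - (f x)\<^sup>2\<bar> \<partial>M) \<le> (\<integral>x. a n x * a n x + 2 * (a n x * \<bar>f x\<bar>) \<partial>M)"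
    proof (rule integral_mono)
      show "integrable M (\<lambda>x. \<bar>(u n x)\<^sup>2 - (f x)\<^sup>2\<bar>)"
        using u[of n] f by (auto simp: L2_def)
      show "integrable M (\<lambda>x. a n x * a n x + 2 * (a n x * \<bar>f x\<bar>))"
        using aL fL by (intro Bochner_Integration.integrable_add integrable_mult_right L2_mult_integrable)
      fix x
      have "\<bar>(u n x)\<^sup>2 - (f x)\<^sup>2\<bar> = a n x * \<bar>(u n x - f x) + 2 * f x\<bar>"
        by (simp add: a_def power2_eq_square flip: abs_mult) (simp add: algebra_simps)
      also have "\<dots> \<le> a n x * (a n x + 2 * \<bar>f x\<bar>)"
        unfolding a_def by (intro mult_left_mono) auto
      finally show "\<bar>(u n x)\<^sup>2 - (f x)\<^sup>2\<bar> \<le> a n x * a n x + 2 * (a n x * \<bar>f x\<bar>)"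
        by (simp add: algebra_simps)
    qed
    also have "\<dots> = (\<integral>x. a n x * a n x \<partial>M) + 2 * (\<integral>x. a n x * \<bar>f x\<bar> \<partial>M)"
      using aL fL by (simp add: L2_mult_integrable)
    finally show ?thesis .
  qed
  have "(\<lambda>n. (\<integral>x. a n x * a n x \<partial>M) + 2 * (\<integral>x. a n x * \<bar>f x\<bar> \<partial>M)) \<longlonglongrightarrow> 0 + 2 * 0"
    using lim' cross by (intro tendsto_intros)
  then have null: "(\<lambda>n. (\<integral>x. a n x * a n x \<partial>M) + 2 * (\<integral>x. a n x * \<bar>f x\<bar> \<partial>M)) \<longlonglongrightarrow> 0"
    by simp
  show ?thesis
    by (rule Lim_null_comparison[OF always_eventually null]) (simp add: bound)
qed

definition truncate :: "real \<Rightarrow> ('a \<Rightarrow> real) \<Rightarrow> 'a \<Rightarrow> real" where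
  "truncate c f x = min (max (f x) (- c)) c"

lemma truncate_tendsto_L2:
  assumes f: "f \<in> L2 M"
  shows "(\<lambda>n. \<integral>x. (truncate (real (Suc n)) f x - f x) * (truncate (real (Suc n)) f x - f x) \<partial>M) \<longlonglongrightarrow> 0"
proof -
  have "(\<lambda>n. \<integral>x. (truncate (real (Suc n)) f x - f x) * (truncate (real (Suc n)) f x - f x) \<partial>M)
      \<longlonglongrightarrow> (\<integral>x. 0 \<partial>M)"
  proof (rule integral_dominated_convergence[where w = "\<lambda>x. (f x)\<^sup>2"])
    show "AE x in M. (\<lambda>n. (truncate (real (Suc n)) f x - f x) * (truncate (real (Suc n)) f x - f x))
        \<longlonglongrightarrow> 0"
    proof (rule AE_I2)
      fix x
      obtain N where N: "\<bar>f x\<bar> \<le> real N"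
        using real_arch_simple by blast
      show "(\<lambda>n. (truncate (real (Suc n)) f x - f x) * (truncate (real (Suc n)) f x - f x)) \<longlonglongrightarrow> 0"
        by (rule tendsto_eventually, rule eventually_sequentiallyI[of N])
           (use N in \<open>auto simp: truncate_def min_def max_def\<close>)
    qed
    show "AE x in M. norm ((truncate (real (Suc n)) f x - f x) * (truncate (real (Suc n)) f x - f x))
        \<le> (f x)\<^sup>2" for n
    proof (rule AE_I2)
      fix x
      have "\<bar>truncate (real (Suc n)) f x - f x\<bar> \<le> \<bar>f x\<bar>"
        by (auto simp: truncate_def min_def max_def)
      from power_mono[OF this, of 2]
      show "norm ((truncate (real (Suc n)) f x - f x) * (truncate (real (Suc n)) f x - f x)) \<le> (f x)\<^sup>2"
        by (simp add: power2_eq_square)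
    qed
  qed (use f in \<open>auto simp: L2_def truncate_def [abs_def]\<close>)
  then show ?thesis by simp
qed

section \<open>Truncations in a strongly local Dirichlet form\<close>

locale strongly_local_dirichlet_form =
  fixes M :: "'a measure" and V :: "('a \<Rightarrow> real) set"
    and \<E> :: "('a \<Rightarrow> real) \<Rightarrow> ('a \<Rightarrow> real) \<Rightarrow> real"
  assumes dirichlet: "dirichlet_form M V \<E>"
    and locality: "strongly_local M V \<E>"
begin

text \<open>
  The defining conjuncts are separated so that proof search for one of them does not have to face
  the quantifier over sequences in the closedness condition.
\<close>

lemma dirichlet_form_parts:
  shows "V \<subseteq> L2 M"
    and "\<forall>f\<in>V. \<forall>g\<in>borel_measurable M. (AE x in M. f x = g x) \<longrightarrow> g \<in> V"
    and "\<forall>f\<in>V. \<forall>f'\<in>V. \<forall>g\<in>V. (AE x in M. f x = f' x) \<longrightarrow> \<E> f g = \<E> f' g"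
    and "(\<lambda>x. 0) \<in> V"
    and "\<forall>f\<in>V. \<forall>g\<in>V. (\<lambda>x. f x + g x) \<in> V"
    and "\<forall>f\<in>V. \<forall>c. (\<lambda>x. c * f x) \<in> V"
    and "\<forall>f\<in>V. \<forall>g\<in>V. \<E> f g = \<E> g f"
    and "\<forall>f\<in>V. \<forall>g\<in>V. \<forall>h\<in>V. \<E> (\<lambda>x. f x + g x) h = \<E> f h + \<E> g h"
    and "\<forall>f\<in>V. \<forall>h\<in>V. \<forall>c. \<E> (\<lambda>x. c * f x) h = c * \<E> f h"
    and "\<forall>f\<in>V. \<E> f f \<ge> 0"
    and "\<forall>f\<in>L2 M. \<forall>e>0. \<exists>g\<in>V. L2norm M (\<lambda>x. f x - g x) < e"
    and "\<forall>u :: nat \<Rightarrow> 'a \<Rightarrow> real.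
        (\<forall>n. u n \<in> V) \<and>
        (\<forall>e>0. \<exists>n0. \<forall>m\<ge>n0. \<forall>n\<ge>n0.
           (L2norm M (\<lambda>x. u m x - u n x))\<^sup>2
             + \<E> (\<lambda>x. u m x - u n x) (\<lambda>x. u m x - u n x) < e) \<longrightarrow>
        (\<exists>f\<in>V. (\<lambda>n. (L2norm M (\<lambda>x. u n x - f x))\<^sup>2
             + \<E> (\<lambda>x. u n x - f x) (\<lambda>x. u n x - f x)) \<longlonglongrightarrow> 0)"
    and "\<forall>f\<in>V. (\<lambda>x. min (max (f x) 0) 1) \<in> V \<and>
        \<E> (\<lambda>x. min (max (f x) 0) 1) (\<lambda>x. min (max (f x) 0) 1) \<le> \<E> f f"
  by (insert dirichlet, unfold dirichlet_form_def) (elim conjE, assumption)+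

lemmas V_L2 = dirichlet_form_parts(1)[THEN subsetD]
  and V_cong_AE = dirichlet_form_parts(2)[rule_format]
  and form_cong_AE = dirichlet_form_parts(3)[rule_format]
  and V_dense = dirichlet_form_parts(11)[rule_format]
  and V_complete = dirichlet_form_parts(12)[rule_format]
  and unit_contraction = dirichlet_form_parts(13)[rule_format]

lemma local_orthogonal:
  "\<lbrakk>f \<in> V; g \<in> V; \<And>x. (f x + a) * g x = 0\<rbrakk> \<Longrightarrow> \<E> f g = 0"
  by (rule locality[unfolded strongly_local_def, rule_format]) (auto intro: exI[of _ a])

sublocale E: function_form V \<E>
  by unfold_locales
    (rule dirichlet_form_parts(4-10)[rule_format] | assumption)+

sublocale L: function_form "L2 M" "\<lambda>f g. \<integral>x. f x * g x \<partial>M"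
  by (rule L2_inner_form)

definition E1 :: "('a \<Rightarrow> real) \<Rightarrow> ('a \<Rightarrow> real) \<Rightarrow> real" where
  "E1 f g = (\<integral>x. f x * g x \<partial>M) + \<E> f g"

sublocale E1: function_form V E1
proof
  show "E1 f g = E1 g f" if "f \<in> V" "g \<in> V" for f g
    using E.sym[OF that] by (simp add: E1_def mult.commute)
  show "E1 (\<lambda>x. f x + g x) h = E1 f h + E1 g h" if "f \<in> V" "g \<in> V" "h \<in> V" for f g h
    using that by (simp add: E1_def E.add_left L.add_left V_L2)
  show "E1 (\<lambda>x. c * f x) h = c * E1 f h" if "f \<in> V" "h \<in> V" for f h c
    using that by (simp add: E1_def E.scale_left L.scale_left V_L2 distrib_left)
  show "0 \<le> E1 f f" if "f \<in> V" for f
    using that by (simp add: E1_def E.nonneg)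
qed (fact E.zero_mem E.add_mem E.scale_mem)+

lemma E1_energy: "E1 f f = (L2norm M f)\<^sup>2 + \<E> f f"
  by (simp add: E1_def L2norm_squared)

lemma E1_complete:
  assumes "\<And>n. u n \<in> V" "E1.form_Cauchy u"
  shows "\<exists>f\<in>V. (\<lambda>n. E1 (\<lambda>x. u n x - f x) (\<lambda>x. u n x - f x)) \<longlonglongrightarrow> 0"
  by (rule V_complete[of u, folded E1_energy, folded E1.form_Cauchy_def]) (simp add: assms)

lemma E1_cong_AE:
  assumes f: "f \<in> V" and g: "g \<in> V" and ae: "AE x in M. f x = g x"
  shows "E1 f f = E1 g g"
proof -
  have "\<E> f f = \<E> g g"
    using form_cong_AE[OF f g f ae] form_cong_AE[OF f g g ae] E.sym[OF f g] by simp
  moreover have "(\<integral>x. f x * f x \<partial>M) = (\<integral>x. g x * g x \<partial>M)"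
    using V_L2[OF f] V_L2[OF g] ae by (intro integral_cong_AE) (auto simp: L2_def)
  ultimately show ?thesis by (simp add: E1_def)
qed

lemma E1_tendsto_iff:
  assumes "\<And>n. w n \<in> V"
  shows "(\<lambda>n. E1 (w n) (w n)) \<longlonglongrightarrow> 0 \<longleftrightarrow>
    (\<lambda>n. \<integral>x. w n x * w n x \<partial>M) \<longlonglongrightarrow> 0 \<and> (\<lambda>n. \<E> (w n) (w n)) \<longlonglongrightarrow> 0"
proof (intro iffI conjI)
  assume lim: "(\<lambda>n. E1 (w n) (w n)) \<longlonglongrightarrow> 0"
  have nn: "0 \<le> \<E> (w n) (w n)" "0 \<le> (\<integral>x. w n x * w n x \<partial>M)" for n
    using assms by (auto intro: E.nonneg)
  show "(\<lambda>n. \<integral>x. w n x * w n x \<partial>M) \<longlonglongrightarrow> 0"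
    by (rule Lim_null_comparison[OF _ lim]) (use nn in \<open>auto simp: E1_def\<close>)
  show "(\<lambda>n. \<E> (w n) (w n)) \<longlonglongrightarrow> 0"
    by (rule Lim_null_comparison[OF _ lim]) (use nn in \<open>auto simp: E1_def\<close>)
next
  assume "(\<lambda>n. \<integral>x. w n x * w n x \<partial>M) \<longlonglongrightarrow> 0 \<and> (\<lambda>n. \<E> (w n) (w n)) \<longlonglongrightarrow> 0"
  then show "(\<lambda>n. E1 (w n) (w n)) \<longlonglongrightarrow> 0"
    unfolding E1_def using tendsto_add_zero by blast
qed

text \<open>
  The Markov property speaks about contractions to \<open>[0, 1]\<close>, not about symmetric truncations.
  The truncation is therefore split into its positive and negative part, each of which is a
  rescaled unit contraction; strong locality makes the two parts \<open>\<E>\<close>-orthogonal.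
\<close>

definition pos_cut :: "real \<Rightarrow> ('a \<Rightarrow> real) \<Rightarrow> 'a \<Rightarrow> real" where
  "pos_cut c f x = min (max (f x) 0) c"

lemma truncate_eq_pos_cuts:
  assumes "c > 0"
  shows "truncate c f = (\<lambda>x. pos_cut c f x - pos_cut c (\<lambda>y. - f y) x)"
  by (rule ext) (use assms in \<open>simp add: truncate_def pos_cut_def min_def max_def\<close>)

lemma pos_cut_contraction:
  assumes f: "f \<in> V" and c: "c > 0"
  shows "pos_cut c f \<in> V" and "\<E> (pos_cut c f) (pos_cut c f) \<le> \<E> f f"
proof -
  define g where "g = (\<lambda>x. 1 / c * f x)"
  define p where "p = (\<lambda>x. min (max (g x) 0) 1)"
  have g: "g \<in> V"
    unfolding g_def using f by (rule E.scale_mem)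
  have p: "p \<in> V" "\<E> p p \<le> \<E> g g"
    using unit_contraction[OF g] by (auto simp: p_def)
  have eq: "pos_cut c f = (\<lambda>x. c * p x)"
    using c by (auto simp: pos_cut_def p_def g_def min_def max_def field_simps)
  show "pos_cut c f \<in> V"
    unfolding eq using p(1) by (rule E.scale_mem)
  have "\<E> (pos_cut c f) (pos_cut c f) = c * (c * \<E> p p)"
    unfolding eq using p by (simp add: E.scale_left E.scale_right E.scale_mem)
  also have "\<dots> \<le> c * (c * \<E> g g)"
    using p c by simp
  also have "\<dots> = \<E> f f"
    unfolding g_def using f c by (simp only: E.scale_left E.scale_right E.scale_mem) simp
  finally show "\<E> (pos_cut c f) (pos_cut c f) \<le> \<E> f f" .
qed

lemma truncate_mem: "\<lbrakk>f \<in> V; c > 0\<rbrakk> \<Longrightarrow> truncate c f \<in> V"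
  by (subst truncate_eq_pos_cuts) (auto intro!: E.diff_mem[OF pos_cut_contraction(1) pos_cut_contraction(1)[OF E.uminus_mem]])

text \<open>
  The factor \<open>2\<close> arises because the positive and the negative part are each compared with all
  of \<open>f\<close>. The bound is uniform in \<open>c\<close>, which is what makes the increasing energies converge.
\<close>

lemma truncate_energy_le:
  assumes f: "f \<in> V" and c: "c > 0"
  shows "\<E> (truncate c f) (truncate c f) \<le> 2 * \<E> f f"
proof -
  let ?p = "pos_cut c f" and ?q = "pos_cut c (\<lambda>y. - f y)"
  have mf: "(\<lambda>y. - f y) \<in> V"
    using f by (rule E.uminus_mem)
  have "\<E> (\<lambda>y. - f y) (\<lambda>y. - f y) = \<E> f f"
    using E.diff_square[OF E.zero_mem f] E.scale_left[OF E.zero_mem E.zero_mem, of 0]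
      E.scale_left[OF E.zero_mem f, of 0] by simp
  then have q: "\<E> ?q ?q \<le> \<E> f f"
    using pos_cut_contraction(2)[OF mf c] by simp
  (* at every point one of the two parts vanishes *)
  have "\<E> ?p ?q = 0"
    by (rule local_orthogonal[where a = 0])
       (use f mf c in \<open>auto simp: pos_cut_contraction pos_cut_def min_def max_def\<close>)
  then show ?thesis
    using q pos_cut_contraction[OF f c] pos_cut_contraction[OF mf c] c
    by (simp add: truncate_eq_pos_cuts E.diff_square)
qed

text \<open>
  Where the increment \<open>truncate d f - truncate c f\<close> does not vanish, \<open>truncate c f\<close> is locally
  constant: equal to \<open>c\<close> on \<open>{f > c}\<close> and to \<open>-c\<close> on \<open>{f < -c}\<close>. Strong locality admits a single
  constant at a time, so the positive and negative parts are treated separately, with the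
  constant \<open>c\<close> for equal signs and \<open>0\<close> for opposite signs.
\<close>

lemma truncate_orthogonal:
  assumes f: "f \<in> V" and c: "0 < c" and d: "c \<le> d"
  shows "\<E> (truncate c f) (\<lambda>x. truncate d f x - truncate c f x) = 0"
proof -
  define p where "p = (\<lambda>c. pos_cut c f)"
  define q where "q = (\<lambda>c. pos_cut c (\<lambda>y. - f y))"
  have d0: "0 < d" using c d by simp
  have V: "p c \<in> V" "p d \<in> V" "q c \<in> V" "q d \<in> V"
    using f c d0 by (auto simp: p_def q_def intro: pos_cut_contraction E.uminus_mem)
  have orth_p: "\<E> (p c) (\<lambda>x. p d x - p c x) = 0"
    by (rule local_orthogonal[where a = "- c", OF V(1) E.diff_mem[OF V(2,1)]])
       (use c d in \<open>auto simp: p_def pos_cut_def min_def max_def\<close>)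
  have orth_q: "\<E> (q c) (\<lambda>x. q d x - q c x) = 0"
    by (rule local_orthogonal[where a = "- c", OF V(3) E.diff_mem[OF V(4,3)]])
       (use c d in \<open>auto simp: q_def pos_cut_def min_def max_def\<close>)
  have cross: "\<E> (p a) (q b) = 0" if "p a \<in> V" "q b \<in> V" "0 < a" "0 < b" for a b
    by (rule local_orthogonal[where a = 0, OF that(1,2)])
       (use that in \<open>auto simp: p_def q_def pos_cut_def min_def max_def\<close>)
  have "\<E> (p c) (q c) = 0" "\<E> (p c) (q d) = 0" "\<E> (q c) (p c) = 0" "\<E> (q c) (p d) = 0"
    using cross V c d0 E.sym by simp_all
  moreover have "truncate c f = (\<lambda>x. p c x - q c x)" "truncate d f = (\<lambda>x. p d x - q d x)"
    using c d0 by (simp_all add: truncate_eq_pos_cuts p_def q_def)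
  ultimately show ?thesis
    using orth_p orth_q V by (simp add: E.diff_left E.diff_right E.diff_mem)
qed

text \<open>
  Completeness of \<open>V\<close> provides some limit of the Cauchy sequence of truncations; it agrees with \<open>f\<close>
  almost everywhere because the truncations tend to \<open>f\<close> in \<open>L\<^sup>2\<close>.
\<close>

lemma truncate_tendsto:
  assumes f: "f \<in> V"
  shows "(\<lambda>n. E1 (\<lambda>x. truncate (real (Suc n)) f x - f x) (\<lambda>x. truncate (real (Suc n)) f x - f x))
    \<longlonglongrightarrow> 0"
proof -
  define u where "u = (\<lambda>n. truncate (real (Suc n)) f)"
  have u: "u n \<in> V" for n
    using f by (simp add: u_def truncate_mem)
  have L_lim: "(\<lambda>n. \<integral>x. (u n x - f x) * (u n x - f x) \<partial>M) \<longlonglongrightarrow> 0"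
    unfolding u_def using truncate_tendsto_L2[OF V_L2[OF f]] .
  have E_Cauchy: "E.form_Cauchy u"
  proof (rule E.Cauchy_of_orthogonal_increments[OF u])
    show "\<E> (u n) (\<lambda>x. u m x - u n x) = 0" if "n \<le> m" for n m
      unfolding u_def using f that by (intro truncate_orthogonal) auto
    show "\<E> (u n) (u n) \<le> 2 * \<E> f f" for n
      unfolding u_def using f by (intro truncate_energy_le) auto
  qed
  have tri: "(\<integral>x. (u m x - u n x) * (u m x - u n x) \<partial>M)
      \<le> 2 * (\<integral>x. (u m x - f x) * (u m x - f x) \<partial>M) + 2 * (\<integral>x. (u n x - f x) * (u n x - f x) \<partial>M)" for m n
    using L.diff_square_le[OF L.diff_mem[OF V_L2 V_L2] L.diff_mem[OF V_L2 V_L2], OF u f u f, of m n]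
    by simp
  have "E1.form_Cauchy u"
    unfolding E1.form_Cauchy_def
  proof (intro allI impI)
    fix e :: real assume "e > 0"
    then have "0 < e / 8" "0 < e / 2" by auto
    obtain n1 where n1: "\<forall>n\<ge>n1. (\<integral>x. (u n x - f x) * (u n x - f x) \<partial>M) < e / 8"
      using order_tendstoD(2)[OF L_lim \<open>0 < e / 8\<close>] unfolding eventually_sequentially by (elim exE)
    obtain n2 where n2: "\<forall>m\<ge>n2. \<forall>n\<ge>n2. \<E> (\<lambda>x. u m x - u n x) (\<lambda>x. u m x - u n x) < e / 2"
      using E_Cauchy[unfolded E.form_Cauchy_def, rule_format, OF \<open>0 < e / 2\<close>] by (elim exE)
    have "E1 (\<lambda>x. u m x - u n x) (\<lambda>x. u m x - u n x) < e"
      if "m \<ge> max n1 n2" "n \<ge> max n1 n2" for m n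
    proof -
      have "\<E> (\<lambda>x. u m x - u n x) (\<lambda>x. u m x - u n x) < e / 2"
        using n2 that by simp
      then show ?thesis
        using that n1[rule_format, of m] n1[rule_format, of n] tri[of m n] by (simp add: E1_def)
    qed
    then show "\<exists>n0. \<forall>m\<ge>n0. \<forall>n\<ge>n0. E1 (\<lambda>x. u m x - u n x) (\<lambda>x. u m x - u n x) < e"
      by (intro exI[of _ "max n1 n2"]) simp
  qed
  from E1_complete[OF u this] obtain g where g: "g \<in> V" and g_lim: "(\<lambda>n. E1 (\<lambda>x. u n x - g x) (\<lambda>x. u n x - g x)) \<longlonglongrightarrow> 0"
    by (elim bexE)
  have dg: "(\<lambda>x. u n x - g x) \<in> V" and df: "(\<lambda>x. u n x - f x) \<in> V" for n
    using u f g by (auto intro: E.diff_mem)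
  have g_L: "(\<lambda>n. \<integral>x. (u n x - g x) * (u n x - g x) \<partial>M) \<longlonglongrightarrow> 0"
    using g_lim dg by (subst (asm) E1_tendsto_iff) auto
  have "(\<integral>x. (g x - f x) * (g x - f x) \<partial>M)
      \<le> 2 * (\<integral>x. (u n x - f x) * (u n x - f x) \<partial>M) + 2 * (\<integral>x. (u n x - g x) * (u n x - g x) \<partial>M)" for n
    using L.diff_square_le[OF V_L2[OF df] V_L2[OF dg], of n n] by simp
  moreover have "(\<lambda>n. 2 * (\<integral>x. (u n x - f x) * (u n x - f x) \<partial>M)
      + 2 * (\<integral>x. (u n x - g x) * (u n x - g x) \<partial>M)) \<longlonglongrightarrow> 2 * 0 + 2 * 0"
    by (intro tendsto_intros L_lim g_L)
  ultimately have "(\<integral>x. (g x - f x) * (g x - f x) \<partial>M) \<le> 0"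
    by (intro LIMSEQ_le_const) auto
  moreover have "0 \<le> (\<integral>x. (g x - f x) * (g x - f x) \<partial>M)"
    by simp
  ultimately have "AE x in M. g x - f x = 0"
    using f g by (intro L2_eq_AE_of_zero_norm L.diff_mem V_L2) auto
  then have "E1 (\<lambda>x. u n x - f x) (\<lambda>x. u n x - f x) = E1 (\<lambda>x. u n x - g x) (\<lambda>x. u n x - g x)" for n
    by (intro E1_cong_AE df dg) auto
  with g_lim show ?thesis by (simp add: u_def)
qed

text \<open>
  This is \<open>truncate_orthogonal\<close> with \<open>d\<close> sent to infinity.
\<close>

lemma truncate_orthogonal_remainder:
  assumes f: "f \<in> V" and c: "c > 0"
  shows "\<E> (truncate c f) (\<lambda>x. f x - truncate c f x) = 0"
proof -
  let ?u = "\<lambda>n. truncate (real (Suc n)) f"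
  have T: "truncate c f \<in> V" and u: "?u n \<in> V" for n
    using f c by (auto intro: truncate_mem)
  obtain N where N: "c \<le> real N"
    using real_arch_simple by blast
  have "(\<lambda>n. \<E> (?u n) (truncate c f)) \<longlonglongrightarrow> \<E> f (truncate c f)"
    using truncate_tendsto[OF f] u f
    by (intro E.tendsto_left T) (auto simp: E1_tendsto_iff E.diff_mem)
  moreover have "\<E> (?u n) (truncate c f) = \<E> (truncate c f) (truncate c f)" if "n \<ge> N" for n
    using truncate_orthogonal[OF f c, of "real (Suc n)"] N that E.sym[OF u T, of n]
    by (simp add: E.diff_right T u del: of_nat_Suc)
  then have "(\<lambda>n. \<E> (?u n) (truncate c f)) \<longlonglongrightarrow> \<E> (truncate c f) (truncate c f)"
    by (intro tendsto_eventually eventually_sequentiallyI)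
  ultimately have "\<E> f (truncate c f) = \<E> (truncate c f) (truncate c f)"
    using LIMSEQ_unique by blast
  then show ?thesis
    using f T E.sym[OF f T] by (simp add: E.diff_right)
qed

section \<open>The resolvent and the Laplacian\<close>

text \<open>
  Below, the equation \<open>E1 u v = \<integral> g v\<close> for all \<open>v\<close> in \<open>V\<close> is the weak form of \<open>u - \<Delta> u = g\<close>.
\<close>

lemma resolvent_exists:
  assumes g: "g \<in> L2 M"
  shows "\<exists>u\<in>V. \<forall>v\<in>V. E1 u v = (\<integral>x. g x * v x \<partial>M)"
proof (rule E1.Riesz_representation[where C = "\<integral>x. g x * g x \<partial>M"])
  show "(\<integral>x. g x * v x \<partial>M)\<^sup>2 \<le> (\<integral>x. g x * g x \<partial>M) * E1 v v" if v: "v \<in> V" for v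
  proof -
    have "(\<integral>x. g x * v x \<partial>M)\<^sup>2 \<le> (\<integral>x. g x * g x \<partial>M) * (\<integral>x. v x * v x \<partial>M)"
      using g V_L2[OF v] by (rule L.Cauchy_Schwarz)
    also have "\<dots> \<le> (\<integral>x. g x * g x \<partial>M) * E1 v v"
      using E.nonneg[OF v] by (intro mult_left_mono) (auto simp: E1_def)
    finally show ?thesis .
  qed
qed (use g in \<open>auto simp: E1_complete L.add_right L.scale_right V_L2\<close>)

text \<open>
  Testing the equation with \<open>u\<close> gives \<open>E1 u u = \<integral> g u\<close>, and
  \<open>2 \<integral> g u \<le> \<integral> g\<^sup>2 + \<integral> u\<^sup>2 \<le> \<integral> g\<^sup>2 + E1 u u\<close>.
\<close>

lemma resolvent_energy_le:
  assumes u: "u \<in> V" and g: "g \<in> L2 M"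
    and eq: "\<And>v. v \<in> V \<Longrightarrow> E1 u v = (\<integral>x. g x * v x \<partial>M)"
  shows "E1 u u \<le> (\<integral>x. g x * g x \<partial>M)"
proof -
  have "0 \<le> (\<integral>x. (g x - u x) * (g x - u x) \<partial>M)"
    by simp
  also have "\<dots> = (\<integral>x. g x * g x \<partial>M) - 2 * (\<integral>x. g x * u x \<partial>M) + (\<integral>x. u x * u x \<partial>M)"
    using g V_L2[OF u] by (rule L.diff_square)
  finally show ?thesis
    using eq[OF u] E.nonneg[OF u] by (simp add: E1_def)
qed

text \<open>
  Test the equation with the excess \<open>v = u - truncate c u\<close>. Orthogonality of the truncation and its
  remainder gives \<open>\<E> u v = \<E> v v \<ge> 0\<close>, so \<open>\<integral> (u - g) v \<le> 0\<close>. But \<open>(u - g) v\<close> is nonnegative, and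
  positive wherever \<open>\<bar>u\<bar> > c\<close>, because there \<open>\<bar>g\<bar> \<le> c < \<bar>u\<bar>\<close> and \<open>u\<close>, \<open>v\<close> have the same sign.
\<close>

lemma resolvent_bounded:
  assumes u: "u \<in> V" and g: "g \<in> L2 M"
    and eq: "\<And>v. v \<in> V \<Longrightarrow> E1 u v = (\<integral>x. g x * v x \<partial>M)"
    and c: "c > 0" and bdd: "AE x in M. \<bar>g x\<bar> \<le> c"
  shows "AE x in M. \<bar>u x\<bar> \<le> c"
proof -
  define v where "v = (\<lambda>x. u x - truncate c u x)"
  have T: "truncate c u \<in> V"
    using u c by (rule truncate_mem)
  have v: "v \<in> V"
    unfolding v_def using u T by (rule E.diff_mem)
  have gu: "(\<lambda>x. u x - g x) \<in> L2 M"
    using V_L2[OF u] g by (rule L.diff_mem)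
  have "\<E> u v = \<E> v v"
    using truncate_orthogonal_remainder[OF u c] E.diff_left[OF u T v] by (simp add: v_def)
  then have "\<E> u v \<ge> 0"
    using E.nonneg[OF v] by simp
  moreover have "(\<integral>x. (u x - g x) * v x \<partial>M) = (\<integral>x. u x * v x \<partial>M) - (\<integral>x. g x * v x \<partial>M)"
    using V_L2[OF u] g V_L2[OF v] by (rule L.diff_left)
  ultimately have le: "(\<integral>x. (u x - g x) * v x \<partial>M) \<le> 0"
    using eq[OF v] by (simp add: E1_def)
  have nn: "AE x in M. 0 \<le> (u x - g x) * v x"
    using bdd
  proof eventually_elim
    case (elim x)
    then show ?case
      by (auto simp: v_def truncate_def min_def max_def zero_le_mult_iff)
  qed
  have "(\<integral>x. (u x - g x) * v x \<partial>M) = 0"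
    using le integral_nonneg_AE[OF nn] by simp
  then have "AE x in M. (u x - g x) * v x = 0"
    using integral_nonneg_eq_0_iff_AE[OF L2_mult_integrable[OF gu V_L2[OF v]] nn] by simp
  with bdd show ?thesis
  proof eventually_elim
    case (elim x)
    then show ?case
      using c by (auto simp: v_def truncate_def min_def max_def split: if_splits)
  qed
qed

text \<open>
  The difference of two Laplacians is orthogonal to \<open>V\<close>, which is dense in \<open>L\<^sup>2\<close>.
\<close>

lemma has_laplacian_unique:
  assumes h: "has_laplacian M V \<E> f h" and k: "has_laplacian M V \<E> f k"
  shows "AE x in M. h x = k x"
proof -
  define w where "w = (\<lambda>x. h x - k x)"
  have L: "h \<in> L2 M" "k \<in> L2 M"
    using h k by (auto simp: has_laplacian_def)
  then have w: "w \<in> L2 M"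
    unfolding w_def by (rule L.diff_mem)
  have orth: "(\<integral>x. w x * g x \<partial>M) = 0" if g: "g \<in> V" for g
    using h k g L.diff_left[OF L V_L2[OF g]] by (auto simp: has_laplacian_def w_def)
  have "(\<integral>x. w x * w x \<partial>M) \<le> e" if "e > 0" for e
  proof -
    obtain g where g: "g \<in> V" and "L2norm M (\<lambda>x. w x - g x) < sqrt e"
      using V_dense[OF w, of "sqrt e"] \<open>e > 0\<close> by auto
    then have "(\<integral>x. (w x - g x)\<^sup>2 \<partial>M) < e"
      by (simp add: L2norm_def)
    then have "(\<integral>x. (w x - g x) * (w x - g x) \<partial>M) < e"
      by (simp add: power2_eq_square)
    moreover have "0 \<le> (\<integral>x. g x * g x \<partial>M)"
      by simp
    ultimately show ?thesis
      using L.diff_square[OF w V_L2[OF g]] orth[OF g] by linarith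
  qed
  then have "(\<integral>x. w x * w x \<partial>M) \<le> 0"
    by (rule field_le_epsilon[where y = 0, simplified])
  moreover have "0 \<le> (\<integral>x. w x * w x \<partial>M)"
    by simp
  ultimately have "AE x in M. w x = 0"
    by (intro L2_eq_AE_of_zero_norm w) auto
  then show ?thesis by (simp add: w_def)
qed

lemma has_laplacian_laplacian:
  "f \<in> DLap M V \<E> \<Longrightarrow> has_laplacian M V \<E> f (laplacian M V \<E> f)"
  unfolding laplacian_def DLap_def using someI_ex[of "has_laplacian M V \<E> f"] by simp

lemma laplacian_L2: "f \<in> DLap M V \<E> \<Longrightarrow> laplacian M V \<E> f \<in> L2 M"
  using has_laplacian_laplacian by (auto simp: has_laplacian_def)

lemma resolvent_has_laplacian:
  assumes u: "u \<in> V" and g: "g \<in> L2 M"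
    and eq: "\<And>v. v \<in> V \<Longrightarrow> E1 u v = (\<integral>x. g x * v x \<partial>M)"
  shows "has_laplacian M V \<E> u (\<lambda>x. u x - g x)"
  unfolding has_laplacian_def
proof (intro conjI ballI)
  show "(\<lambda>x. u x - g x) \<in> L2 M"
    using V_L2[OF u] g by (rule L.diff_mem)
  show "\<E> u v = - (\<integral>x. (u x - g x) * v x \<partial>M)" if v: "v \<in> V" for v
    using eq[OF v] L.diff_left[OF V_L2[OF u] g V_L2[OF v]] by (simp add: E1_def)
qed (rule u)

lemma resolvent_equation:
  assumes f: "f \<in> DLap M V \<E>" and v: "v \<in> V"
  shows "E1 f v = (\<integral>x. (f x - laplacian M V \<E> f x) * v x \<partial>M)"
proof -
  have "f \<in> V" "\<E> f v = - (\<integral>x. laplacian M V \<E> f x * v x \<partial>M)"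
    using has_laplacian_laplacian[OF f] v by (auto simp: has_laplacian_def)
  then show ?thesis
    using L.diff_left[OF V_L2 laplacian_L2[OF f] V_L2[OF v], of f] by (simp add: E1_def)
qed

section \<open>Approximation and passage to the limit\<close>

lemma bounded_approximation:
  assumes f: "f \<in> DLap_V M V \<E>"
  shows "\<exists>F. (\<forall>n. F n \<in> DLap_V M V \<E> \<inter> DLap_Linf M V \<E>) \<and>
    (\<lambda>n. E1 (\<lambda>x. F n x - f x) (\<lambda>x. F n x - f x)) \<longlonglongrightarrow> 0 \<and>
    (\<lambda>n. E1 (\<lambda>x. laplacian M V \<E> (F n) x - laplacian M V \<E> f x)
             (\<lambda>x. laplacian M V \<E> (F n) x - laplacian M V \<E> f x)) \<longlonglongrightarrow> 0"
proof -
  let ?\<Delta> = "laplacian M V \<E>"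
  have fD: "f \<in> DLap M V \<E>" and fV: "f \<in> V" and \<Delta>fV: "?\<Delta> f \<in> V"
    using f by (auto simp: DLap_V_def DLap_def)
  define h where "h = (\<lambda>x. f x - ?\<Delta> f x)"
  (* level n + 1 rather than n: truncation needs a positive level *)
  define k where "k = (\<lambda>n. truncate (real (Suc n)) h)"
  have h: "h \<in> V"
    unfolding h_def using fV \<Delta>fV by (rule E.diff_mem)
  have k: "k n \<in> V" for n
    using h by (simp add: k_def truncate_mem)
  have k_bdd: "\<bar>k n x\<bar> \<le> real (Suc n)" for n x
    by (auto simp: k_def truncate_def)
  have "\<forall>n. \<exists>u\<in>V. \<forall>v\<in>V. E1 u v = (\<integral>x. k n x * v x \<partial>M)"
    using resolvent_exists[OF V_L2[OF k]] by blast
  then obtain F where F: "\<And>n. F n \<in> V"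
    and F_eq: "\<And>n v. v \<in> V \<Longrightarrow> E1 (F n) v = (\<integral>x. k n x * v x \<partial>M)"
    by metis
  have F_lap: "has_laplacian M V \<E> (F n) (\<lambda>x. F n x - k n x)" for n
    using F V_L2[OF k] F_eq by (rule resolvent_has_laplacian)
  then have FD: "F n \<in> DLap M V \<E>" for n
    using F by (auto simp: DLap_def)
  have \<Delta>F: "AE x in M. F n x - k n x = ?\<Delta> (F n) x" for n
    using F_lap has_laplacian_laplacian[OF FD] by (rule has_laplacian_unique)
  have \<Delta>F_meas: "?\<Delta> (F n) \<in> borel_measurable M" for n
    using laplacian_L2[OF FD] by (simp add: L2_def)
  have \<Delta>FV: "?\<Delta> (F n) \<in> V" for n
    using E.diff_mem[OF F k] \<Delta>F_meas \<Delta>F by (rule V_cong_AE)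
  have F_bdd: "AE x in M. \<bar>F n x\<bar> \<le> real (Suc n)" for n
    using resolvent_bounded[OF F V_L2[OF k] F_eq, where c = "real (Suc n)"] k_bdd[of n] by simp
  have F_Linf: "F n \<in> Linf M" for n
    using F_bdd V_L2[OF F] by (auto simp: Linf_def L2_def)
  have "AE x in M. \<bar>?\<Delta> (F n) x\<bar> \<le> 2 * real (Suc n)" for n
    using \<Delta>F[of n] F_bdd[of n]
  proof eventually_elim
    case (elim x)
    then show ?case
      using k_bdd[of n x] abs_triangle_ineq4[of "F n x" "k n x"] by simp
  qed
  then have "?\<Delta> (F n) \<in> Linf M" for n
    using \<Delta>F_meas by (auto simp: Linf_def)
  then have mem: "F n \<in> DLap_V M V \<E> \<inter> DLap_Linf M V \<E>" for n
    using FD \<Delta>FV F_Linf by (auto simp: DLap_V_def DLap_Linf_def)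

  (* w is the resolvent of r, so convergence of the data carries over to the solutions *)
  define w where "w = (\<lambda>n x. F n x - f x)"
  define r where "r = (\<lambda>n x. k n x - h x)"
  have w: "w n \<in> V" and r: "r n \<in> V" for n
    unfolding w_def r_def using F fV k h by (auto intro: E.diff_mem)
  have r_lim: "(\<lambda>n. E1 (r n) (r n)) \<longlonglongrightarrow> 0"
    unfolding r_def k_def using h by (rule truncate_tendsto)
  have w_eq: "E1 (w n) v = (\<integral>x. r n x * v x \<partial>M)" if v: "v \<in> V" for n v
    unfolding w_def r_def
    using E1.diff_left[OF F fV v] L.diff_left[OF V_L2 V_L2 V_L2, OF k h v] F_eq[OF v]
      resolvent_equation[OF fD v]
    by (simp add: h_def)
  have w_le: "E1 (w n) (w n) \<le> E1 (r n) (r n)" for n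
    using resolvent_energy_le[OF w V_L2[OF r] w_eq, of n] E.nonneg[OF r, of n]
    by (simp add: E1_def)
  have w_lim: "(\<lambda>n. E1 (w n) (w n)) \<longlonglongrightarrow> 0"
    by (rule Lim_null_comparison[OF always_eventually r_lim]) (simp add: w_le E1.nonneg[OF w])
  have \<Delta>_le: "E1 (\<lambda>x. ?\<Delta> (F n) x - ?\<Delta> f x) (\<lambda>x. ?\<Delta> (F n) x - ?\<Delta> f x) \<le> 4 * E1 (r n) (r n)" for n
  proof -
    have "AE x in M. ?\<Delta> (F n) x - ?\<Delta> f x = w n x - r n x"
      using \<Delta>F[of n] by eventually_elim (simp add: w_def r_def h_def)
    then have "E1 (\<lambda>x. ?\<Delta> (F n) x - ?\<Delta> f x) (\<lambda>x. ?\<Delta> (F n) x - ?\<Delta> f x)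
        = E1 (\<lambda>x. w n x - r n x) (\<lambda>x. w n x - r n x)"
      by (intro E1_cong_AE E.diff_mem \<Delta>FV \<Delta>fV w r)
    also have "\<dots> \<le> 2 * E1 (w n) (w n) + 2 * E1 (r n) (r n)"
      using w r by (rule E1.diff_square_le)
    finally show ?thesis
      using w_le[of n] by simp
  qed
  have "(\<lambda>n. E1 (\<lambda>x. ?\<Delta> (F n) x - ?\<Delta> f x) (\<lambda>x. ?\<Delta> (F n) x - ?\<Delta> f x)) \<longlonglongrightarrow> 0"
  proof (rule Lim_null_comparison[OF always_eventually])
    show "\<forall>n. norm (E1 (\<lambda>x. ?\<Delta> (F n) x - ?\<Delta> f x) (\<lambda>x. ?\<Delta> (F n) x - ?\<Delta> f x)) \<le> 4 * E1 (r n) (r n)"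
      using \<Delta>_le E1.nonneg[OF E.diff_mem[OF \<Delta>FV \<Delta>fV]] by simp
    show "(\<lambda>n. 4 * E1 (r n) (r n)) \<longlonglongrightarrow> 0"
      using r_lim by (rule tendsto_mult_right_zero)
  qed
  with mem w_lim show ?thesis
    unfolding w_def by blast
qed

lemma carre_du_champ_parts:
  assumes "carre_du_champ M V \<E> \<Gamma>"
  shows "\<forall>f\<in>V. \<forall>g\<in>V. integrable M (\<Gamma> f g)"
    and "\<forall>(u :: nat \<Rightarrow> 'a \<Rightarrow> real) v. \<forall>f\<in>V. \<forall>g\<in>V.
        (\<forall>n. u n \<in> V) \<and> (\<forall>n. v n \<in> V) \<and>
        (\<lambda>n. Vnorm M \<Gamma> (\<lambda>x. u n x - f x)) \<longlonglongrightarrow> 0 \<and>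
        (\<lambda>n. Vnorm M \<Gamma> (\<lambda>x. v n x - g x)) \<longlonglongrightarrow> 0 \<longrightarrow>
        (\<lambda>n. \<integral>x. \<bar>\<Gamma> (u n) (v n) x - \<Gamma> f g x\<bar> \<partial>M) \<longlonglongrightarrow> 0"
    and "\<forall>f\<in>V. \<forall>g\<in>V. \<E> f g = (\<integral>x. \<Gamma> f g x \<partial>M)"
  by (insert assms, unfold carre_du_champ_def) (elim conjE, assumption)+

lemmas Gamma_integrable = carre_du_champ_parts(1)[rule_format]
  and Gamma_continuous = carre_du_champ_parts(2)[rule_format]
  and form_eq_integral_Gamma = carre_du_champ_parts(3)[rule_format]

lemma Vnorm_eq:
  assumes "carre_du_champ M V \<E> \<Gamma>" "f \<in> V"
  shows "Vnorm M \<Gamma> f = sqrt (E1 f f)"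
proof -
  have "integrable M (\<Gamma> f f)" "\<E> f f = (\<integral>x. \<Gamma> f f x \<partial>M)"
    using assms by (auto intro: Gamma_integrable form_eq_integral_Gamma)
  moreover have "integrable M (\<lambda>x. (f x)\<^sup>2)"
    using V_L2[OF assms(2)] by (simp add: L2_def)
  ultimately show ?thesis
    by (simp add: Vnorm_def E1_def power2_eq_square)
qed

lemma Vnorm_tendsto_iff:
  assumes "carre_du_champ M V \<E> \<Gamma>" "\<And>n. w n \<in> V"
  shows "(\<lambda>n. Vnorm M \<Gamma> (w n)) \<longlonglongrightarrow> 0 \<longleftrightarrow> (\<lambda>n. E1 (w n) (w n)) \<longlonglongrightarrow> 0"
proof
  assume "(\<lambda>n. Vnorm M \<Gamma> (w n)) \<longlonglongrightarrow> 0"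
  then have "(\<lambda>n. (Vnorm M \<Gamma> (w n))\<^sup>2) \<longlonglongrightarrow> 0\<^sup>2"
    by (rule tendsto_power)
  then show "(\<lambda>n. E1 (w n) (w n)) \<longlonglongrightarrow> 0"
    using assms by (simp add: Vnorm_eq E1.nonneg)
next
  assume "(\<lambda>n. E1 (w n) (w n)) \<longlonglongrightarrow> 0"
  from tendsto_real_sqrt[OF this] show "(\<lambda>n. Vnorm M \<Gamma> (w n)) \<longlonglongrightarrow> 0"
    using assms by (simp add: Vnorm_eq)
qed

lemma BE_terms_tendsto:
  assumes \<Gamma>: "carre_du_champ M V \<E> \<Gamma>"
    and F: "\<And>n. F n \<in> DLap_V M V \<E>" and f: "f \<in> DLap_V M V \<E>" and \<phi>: "\<phi> \<in> DLap_Linf M V \<E>"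
    and lim: "(\<lambda>n. Vnorm M \<Gamma> (\<lambda>x. F n x - f x)) \<longlonglongrightarrow> 0"
    and \<Delta>_lim: "(\<lambda>n. Vnorm M \<Gamma> (\<lambda>x. laplacian M V \<E> (F n) x - laplacian M V \<E> f x)) \<longlonglongrightarrow> 0"
  shows "(\<lambda>n. Gamma2 M V \<E> \<Gamma> (F n) \<phi>) \<longlonglongrightarrow> Gamma2 M V \<E> \<Gamma> f \<phi>"
    and "(\<lambda>n. \<integral>x. \<Gamma> (F n) (F n) x * \<phi> x \<partial>M) \<longlonglongrightarrow> (\<integral>x. \<Gamma> f f x * \<phi> x \<partial>M)"
    and "(\<lambda>n. \<integral>x. (laplacian M V \<E> (F n) x)\<^sup>2 * \<phi> x \<partial>M)
      \<longlonglongrightarrow> (\<integral>x. (laplacian M V \<E> f x)\<^sup>2 * \<phi> x \<partial>M)"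
proof -
  let ?\<Delta> = "laplacian M V \<E>"
  note int = Gamma_integrable[OF \<Gamma>]
  have cont: "(\<lambda>n. \<integral>x. \<bar>\<Gamma> (u n) (v n) x - \<Gamma> a b x\<bar> \<partial>M) \<longlonglongrightarrow> 0"
    if "a \<in> V" "b \<in> V" "\<And>n. u n \<in> V" "\<And>n. v n \<in> V"
      "(\<lambda>n. Vnorm M \<Gamma> (\<lambda>x. u n x - a x)) \<longlonglongrightarrow> 0" "(\<lambda>n. Vnorm M \<Gamma> (\<lambda>x. v n x - b x)) \<longlonglongrightarrow> 0"
    for u v :: "nat \<Rightarrow> 'a \<Rightarrow> real" and a b
    using Gamma_continuous[OF \<Gamma>, of a b u v] that by simp
  have FV: "F n \<in> V" "?\<Delta> (F n) \<in> V" and fV: "f \<in> V" "?\<Delta> f \<in> V" for n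
    using F f by (auto simp: DLap_V_def DLap_def)
  have \<phi>b: "\<phi> \<in> Linf M" "?\<Delta> \<phi> \<in> Linf M"
    using \<phi> by (auto simp: DLap_Linf_def)
  have mult_lim: "(\<lambda>n. \<integral>x. \<Gamma> (F n) (F n) x * \<psi> x \<partial>M) \<longlonglongrightarrow> (\<integral>x. \<Gamma> f f x * \<psi> x \<partial>M)"
    if "\<psi> \<in> Linf M" for \<psi>
    by (rule L1_tendsto_integral_mult_bounded[OF _ _ that cont]) (use FV fV lim int in auto)
  show "(\<lambda>n. \<integral>x. \<Gamma> (F n) (F n) x * \<phi> x \<partial>M) \<longlonglongrightarrow> (\<integral>x. \<Gamma> f f x * \<phi> x \<partial>M)"
    using \<phi>b(1) by (rule mult_lim)
  have mixed_lim: "(\<lambda>n. \<integral>x. \<Gamma> (F n) (?\<Delta> (F n)) x * \<phi> x \<partial>M) \<longlonglongrightarrow> (\<integral>x. \<Gamma> f (?\<Delta> f) x * \<phi> x \<partial>M)"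
    by (rule L1_tendsto_integral_mult_bounded[OF _ _ \<phi>b(1) cont]) (use FV fV lim \<Delta>_lim int in auto)
  have Gamma2_eq: "Gamma2 M V \<E> \<Gamma> u \<phi>
      = 1/2 * (\<integral>x. \<Gamma> u u x * ?\<Delta> \<phi> x \<partial>M) - (\<integral>x. \<Gamma> u (?\<Delta> u) x * \<phi> x \<partial>M)"
    if "u \<in> V" "?\<Delta> u \<in> V" for u
  proof -
    have "integrable M (\<lambda>x. \<Gamma> u u x * ?\<Delta> \<phi> x)" "integrable M (\<lambda>x. \<Gamma> u (?\<Delta> u) x * \<phi> x)"
      using that \<phi>b by (auto intro!: bounded_mult_integrable int)
    then show ?thesis
      unfolding Gamma2_def by (simp add: mult.assoc)
  qed
  show "(\<lambda>n. Gamma2 M V \<E> \<Gamma> (F n) \<phi>) \<longlonglongrightarrow> Gamma2 M V \<E> \<Gamma> f \<phi>"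
    unfolding Gamma2_eq[OF FV] Gamma2_eq[OF fV]
    by (intro tendsto_intros mult_lim mixed_lim \<phi>b)
  have "(\<lambda>n. \<integral>x. (?\<Delta> (F n) x - ?\<Delta> f x) * (?\<Delta> (F n) x - ?\<Delta> f x) \<partial>M) \<longlonglongrightarrow> 0"
    using \<Delta>_lim FV fV by (simp add: Vnorm_tendsto_iff[OF \<Gamma>] E1_tendsto_iff E.diff_mem)
  then have "(\<lambda>n. \<integral>x. \<bar>(?\<Delta> (F n) x)\<^sup>2 - (?\<Delta> f x)\<^sup>2\<bar> \<partial>M) \<longlonglongrightarrow> 0"
    using FV fV by (intro L2_tendsto_imp_squares_L1_tendsto V_L2)
  then show "(\<lambda>n. \<integral>x. (?\<Delta> (F n) x)\<^sup>2 * \<phi> x \<partial>M) \<longlonglongrightarrow> (\<integral>x. (?\<Delta> f x)\<^sup>2 * \<phi> x \<partial>M)"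
    by (rule L1_tendsto_integral_mult_bounded[OF _ _ \<phi>b(1), rotated 2])
       (use V_L2[OF FV(2)] V_L2[OF fV(2)] in \<open>auto simp: L2_def\<close>)
qed

end

theorem lemma4p2:
  fixes M :: "'a::polish_space measure"
    and V :: "('a \<Rightarrow> real) set"
    and \<E> :: "('a \<Rightarrow> real) \<Rightarrow> ('a \<Rightarrow> real) \<Rightarrow> real"
    and \<Gamma> :: "('a \<Rightarrow> real) \<Rightarrow> ('a \<Rightarrow> real) \<Rightarrow> 'a \<Rightarrow> real"
    and P :: "real \<Rightarrow> ('a \<Rightarrow> real) \<Rightarrow> 'a \<Rightarrow> real"
  assumes "sets M = sets borel"
    and "sigma_finite_measure M"
    and "msupport M = UNIV"
    and "dirichlet_form M V \<E>"
    and "strongly_local M V \<E>"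
    and "carre_du_champ M V \<E> \<Gamma>"
    and "markov_semigroup M V \<E> P"
    and "mass_preserving M P"
  shows "(\<forall>f\<in>DLap_V M V \<E>. \<exists>F :: nat \<Rightarrow> 'a \<Rightarrow> real.
            (\<forall>n. F n \<in> DLap_V M V \<E> \<inter> DLap_Linf M V \<E>) \<and>
            (\<lambda>n. Vnorm M \<Gamma> (\<lambda>x. F n x - f x)) \<longlonglongrightarrow> 0 \<and>
            (\<lambda>n. Vnorm M \<Gamma> (\<lambda>x. laplacian M V \<E> (F n) x - laplacian M V \<E> f x)) \<longlonglongrightarrow> 0) \<and>
         (\<forall>(K::real) (N::ereal). 1 \<le> N \<longrightarrow>
            (BE M V \<E> \<Gamma> K N \<longleftrightarrow>
             (\<forall>f\<in>DLap_V M V \<E> \<inter> DLap_Linf M V \<E>.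
                \<forall>\<phi>\<in>DLap_Linf M V \<E>. (AE x in M. 0 \<le> \<phi> x) \<longrightarrow>
                  Gamma2 M V \<E> \<Gamma> f \<phi> \<ge>
                    K * (\<integral>x. \<Gamma> f f x * \<phi> x \<partial>M)
                    + inv_dim N * (\<integral>x. (laplacian M V \<E> f x)\<^sup>2 * \<phi> x \<partial>M))))"
proof -
  interpret strongly_local_dirichlet_form M V \<E>
    using assms(4,5) by (rule strongly_local_dirichlet_form.intro)
  note \<Gamma> = assms(6)
  let ?\<Delta> = "laplacian M V \<E>"
  have approx: "\<exists>F :: nat \<Rightarrow> 'a \<Rightarrow> real.
      (\<forall>n. F n \<in> DLap_V M V \<E> \<inter> DLap_Linf M V \<E>) \<and>
      (\<lambda>n. Vnorm M \<Gamma> (\<lambda>x. F n x - f x)) \<longlonglongrightarrow> 0 \<and>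
      (\<lambda>n. Vnorm M \<Gamma> (\<lambda>x. ?\<Delta> (F n) x - ?\<Delta> f x)) \<longlonglongrightarrow> 0"
    if f: "f \<in> DLap_V M V \<E>" for f
  proof (rule exE[OF bounded_approximation[OF f]])
    fix F
    assume FF: "(\<forall>n. F n \<in> DLap_V M V \<E> \<inter> DLap_Linf M V \<E>) \<and>
        (\<lambda>n. E1 (\<lambda>x. F n x - f x) (\<lambda>x. F n x - f x)) \<longlonglongrightarrow> 0 \<and>
        (\<lambda>n. E1 (\<lambda>x. ?\<Delta> (F n) x - ?\<Delta> f x) (\<lambda>x. ?\<Delta> (F n) x - ?\<Delta> f x)) \<longlonglongrightarrow> 0"
    note F = FF[THEN conjunct1, rule_format]
      and lims = FF[THEN conjunct2, THEN conjunct1] FF[THEN conjunct2, THEN conjunct2]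
    have "F n \<in> V" "?\<Delta> (F n) \<in> V" "f \<in> V" "?\<Delta> f \<in> V" for n
      using F[of n] f by (simp_all add: DLap_V_def DLap_def)
    note V = E.diff_mem[OF this(1,3)] E.diff_mem[OF this(2,4)]
    have "(\<lambda>n. Vnorm M \<Gamma> (\<lambda>x. F n x - f x)) \<longlonglongrightarrow> 0"
      by (rule Vnorm_tendsto_iff[OF \<Gamma>, THEN iffD2, OF V(1) lims(1)])
    moreover have "(\<lambda>n. Vnorm M \<Gamma> (\<lambda>x. ?\<Delta> (F n) x - ?\<Delta> f x)) \<longlonglongrightarrow> 0"
      by (rule Vnorm_tendsto_iff[OF \<Gamma>, THEN iffD2, OF V(2) lims(2)])
    ultimately show ?thesis
      using FF[THEN conjunct1] by (intro exI[of _ F] conjI)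
  qed
  (* the inequality holds along the approximating sequence and is closed under its limit *)
  have BE: "BE M V \<E> \<Gamma> K N"
    if ineq: "\<forall>f\<in>DLap_V M V \<E> \<inter> DLap_Linf M V \<E>.
                \<forall>\<phi>\<in>DLap_Linf M V \<E>. (AE x in M. 0 \<le> \<phi> x) \<longrightarrow>
                  Gamma2 M V \<E> \<Gamma> f \<phi> \<ge>
                    K * (\<integral>x. \<Gamma> f f x * \<phi> x \<partial>M)
                    + inv_dim N * (\<integral>x. (?\<Delta> f x)\<^sup>2 * \<phi> x \<partial>M)" for K N
    unfolding BE_def
  proof (intro ballI impI)
    fix f \<phi>
    assume f: "f \<in> DLap_V M V \<E>" and \<phi>: "\<phi> \<in> DLap_Linf M V \<E>" and pos: "AE x in M. 0 \<le> \<phi> x"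
    show "K * (\<integral>x. \<Gamma> f f x * \<phi> x \<partial>M) + inv_dim N * (\<integral>x. (?\<Delta> f x)\<^sup>2 * \<phi> x \<partial>M)
        \<le> Gamma2 M V \<E> \<Gamma> f \<phi>"
    proof (rule exE[OF approx[OF f]])
      fix F :: "nat \<Rightarrow> 'a \<Rightarrow> real"
      assume FF: "(\<forall>n. F n \<in> DLap_V M V \<E> \<inter> DLap_Linf M V \<E>) \<and>
        (\<lambda>n. Vnorm M \<Gamma> (\<lambda>x. F n x - f x)) \<longlonglongrightarrow> 0 \<and>
        (\<lambda>n. Vnorm M \<Gamma> (\<lambda>x. ?\<Delta> (F n) x - ?\<Delta> f x)) \<longlonglongrightarrow> 0"
      note F = FF[THEN conjunct1, rule_format]
        and lims = FF[THEN conjunct2, THEN conjunct1] FF[THEN conjunct2, THEN conjunct2]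
      note terms = BE_terms_tendsto[OF \<Gamma> IntD1[OF F] f \<phi> lims]
      show ?thesis
      proof (rule LIMSEQ_le[OF _ terms(1)])
        show "(\<lambda>n. K * (\<integral>x. \<Gamma> (F n) (F n) x * \<phi> x \<partial>M)
            + inv_dim N * (\<integral>x. (?\<Delta> (F n) x)\<^sup>2 * \<phi> x \<partial>M))
          \<longlonglongrightarrow> K * (\<integral>x. \<Gamma> f f x * \<phi> x \<partial>M) + inv_dim N * (\<integral>x. (?\<Delta> f x)\<^sup>2 * \<phi> x \<partial>M)"
          by (rule tendsto_add[OF tendsto_mult_left[OF terms(2)] tendsto_mult_left[OF terms(3)]])
        show "\<exists>N0. \<forall>n\<ge>N0. K * (\<integral>x. \<Gamma> (F n) (F n) x * \<phi> x \<partial>M)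
            + inv_dim N * (\<integral>x. (?\<Delta> (F n) x)\<^sup>2 * \<phi> x \<partial>M) \<le> Gamma2 M V \<E> \<Gamma> (F n) \<phi>"
          using ineq[rule_format, OF F \<phi> pos] by (intro exI allI impI)
      qed
    qed
  qed
  have restrict: "\<forall>f\<in>DLap_V M V \<E> \<inter> DLap_Linf M V \<E>.
                \<forall>\<phi>\<in>DLap_Linf M V \<E>. (AE x in M. 0 \<le> \<phi> x) \<longrightarrow>
                  Gamma2 M V \<E> \<Gamma> f \<phi> \<ge>
                    K * (\<integral>x. \<Gamma> f f x * \<phi> x \<partial>M)
                    + inv_dim N * (\<integral>x. (?\<Delta> f x)\<^sup>2 * \<phi> x \<partial>M)"
    if "BE M V \<E> \<Gamma> K N" for K N
    by (intro ballI impI, erule IntE, rule that[unfolded BE_def, rule_format])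
  show ?thesis
    by (rule conjI[OF ballI[OF approx]], assumption, intro allI impI iffI, erule restrict, erule BE)
qed

end
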